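(* (1) There is no function $h\colon\mathbb{N}\to\mathbb{N}$ with $\lim_{n\to\infty}h(n)=\infty$ such that for every sequence $A\in 2^\omega$, the condition "there is a constant $c$ with $\mathrm{K}(A\upharpoonright n)\ge n-h(n)-c$ for all $n$" implies that $A$ is Martin-Löf random. (2) There is no function $h\colon\mathbb{N}\to\mathbb{N}$ with $\lim_{n\to\infty}h(n)=\infty$ such that for every sequence $A\in 2^\omega$, the condition "there is a constant $c$ with $\mathrm{C}(A\upharpoonright n)\ge n-\mathrm{K}(n)-h(n)-c$ for all $n$" implies that $A$ is Martin-Löf random.
   Context: $2^\omega$ is the set of infinite binary sequences; $A\upharpoonright n$ is the prefix of $A$ of length $n$. $\mathrm{K}$ denotes prefix-free Kolmogorov complexity and $\mathrm{C}$ plain Kolmogorov complexity. *)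

theory Defs
  imports "HOL-Probability.Probability" "HOL-Library.Sublist" "HOL-Library.Nat_Bijection"
begin

section \<open>Partial computable functions\<close>

definition mu_search :: "(nat \<rightharpoonup> nat) \<Rightarrow> (nat \<rightharpoonup> nat)" where
  "mu_search f a =
     (if \<exists>n. f (prod_encode (a, n)) = Some 0 \<and> (\<forall>m<n. \<exists>y. f (prod_encode (a, m)) = Some (Suc y))
      then Some (LEAST n. f (prod_encode (a, n)) = Some 0) else None)"

text \<open>
  Kleene's partial recursive functions, in unary form: a tuple of arguments is passed as one number
  through the (primitive recursive) Cantor pairing bijection \<^const>\<open>prod_encode\<close>.
\<close>

inductive partial_computable :: "(nat \<rightharpoonup> nat) \<Rightarrow> bool" where
  zero: "partial_computable (\<lambda>n. Some 0)"
| succ: "partial_computable (\<lambda>n. Some (Suc n))"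
| left: "partial_computable (\<lambda>n. Some (fst (prod_decode n)))"
| right: "partial_computable (\<lambda>n. Some (snd (prod_decode n)))"
| pair: "partial_computable (\<lambda>n. Option.bind (f n) (\<lambda>x.
           Option.bind (g n) (\<lambda>y. Some (prod_encode (x, y)))))"
  if "partial_computable f" and "partial_computable g"
| comp: "partial_computable (\<lambda>n. Option.bind (g n) f)"
  if "partial_computable f" and "partial_computable g"
| prec: "partial_computable (\<lambda>n. case prod_decode n of (a, m) \<Rightarrow>
           rec_nat (f a)
             (\<lambda>k r. Option.bind r (\<lambda>x. g (prod_encode (a, prod_encode (k, x))))) m)"
  if "partial_computable f" and "partial_computable g"
| mu: "partial_computable (mu_search f)"
  if "partial_computable f"

section \<open>Finite binary strings and machines\<close>

text \<open>
  The usual identification of finite binary strings with natural numbers: \<open>str_code \<sigma>\<close> is the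
  position of \<open>\<sigma>\<close> in the length-lexicographic order.
\<close>

definition str_code :: "bool list \<Rightarrow> nat" where
  "str_code \<sigma> = foldl (\<lambda>n b. 2 * n + (if b then 2 else 1)) 0 \<sigma>"

definition str_decode :: "nat \<Rightarrow> bool list" where
  "str_decode = inv str_code"

lemma str_code_Nil [simp]: "str_code [] = 0"
  by (simp add: str_code_def)

lemma str_code_snoc [simp]: "str_code (\<sigma> @ [b]) = 2 * str_code \<sigma> + (if b then 2 else 1)"
  by (simp add: str_code_def)

lemma bij_str_code: "bij str_code"
proof (rule bijI)
  show "inj str_code"
  proof (rule injI)
    fix \<sigma> \<tau> assume "str_code \<sigma> = str_code \<tau>"
    then show "\<sigma> = \<tau>"
    proof (induction \<sigma> arbitrary: \<tau> rule: rev_induct)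
      case Nil
      then show ?case by (cases \<tau> rule: rev_cases) (auto split: if_splits)
    next
      case (snoc b \<sigma>)
      show ?case
      proof (cases \<tau> rule: rev_cases)
        case Nil
        with snoc.prems show ?thesis by (auto split: if_splits)
      next
        case (snoc \<tau>' b')
        with snoc.prems have eq: "2 * str_code \<sigma> + (if b then 2 else 1)
            = 2 * str_code \<tau>' + (if b' then 2 else 1)" by simp
        then have "b = b'" by (cases b; cases b'; simp; presburger)
        with eq snoc.IH have "\<sigma> = \<tau>'" by simp
        with \<open>b = b'\<close> snoc show ?thesis by simp
      qed
    qed
  qed
next
  have "\<exists>\<sigma>. n = str_code \<sigma>" for n
  proof (induction n rule: less_induct)
    case (less n)
    show ?case
    proof (cases "n = 0")
      case True
      then have "n = str_code []" by simp
      then show ?thesis by blast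
    next
      case False
      then have "(n - 1) div 2 < n" by simp
      then obtain \<sigma> where \<sigma>: "(n - 1) div 2 = str_code \<sigma>"
        using less.IH by blast
      have "n = str_code (\<sigma> @ [even n])"
        unfolding str_code_snoc \<sigma>[symmetric] using False by (cases "even n"; simp; presburger)
      then show ?thesis by blast
    qed
  qed
  then show "surj str_code" by (simp add: surj_def)
qed

lemma str_decode_code [simp]: "str_decode (str_code \<sigma>) = \<sigma>"
  by (simp add: str_decode_def bij_is_inj[OF bij_str_code])

lemma str_code_decode [simp]: "str_code (str_decode n) = n"
  by (simp add: str_decode_def bij_is_surj[OF bij_str_code] surj_f_inv_f)

definition machine :: "(bool list \<rightharpoonup> bool list) \<Rightarrow> bool" where
  "machine M \<longleftrightarrow> partial_computable (\<lambda>n. map_option str_code (M (str_decode n)))"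

definition prefix_free_machine :: "(bool list \<rightharpoonup> bool list) \<Rightarrow> bool" where
  "prefix_free_machine M \<longleftrightarrow> machine M \<and> (\<forall>p\<in>dom M. \<forall>q\<in>dom M. prefix p q \<longrightarrow> p = q)"

section \<open>Kolmogorov complexity\<close>

text \<open>
  \<open>U\<close> is optimal in a class of machines if it belongs to the class and describes every string as
  briefly as any other machine of the class does, up to an additive constant.
\<close>

definition optimal_in ::
  "((bool list \<rightharpoonup> bool list) \<Rightarrow> bool) \<Rightarrow> (bool list \<rightharpoonup> bool list) \<Rightarrow> bool" where
  "optimal_in \<M> U \<longleftrightarrow> \<M> U \<and>
     (\<forall>M. \<M> M \<longrightarrow> (\<exists>c. \<forall>p \<sigma>. M p = Some \<sigma> \<longrightarrow> (\<exists>q. U q = Some \<sigma> \<and> length q \<le> length p + c)))"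

abbreviation optimal_machine :: "(bool list \<rightharpoonup> bool list) \<Rightarrow> bool" where
  "optimal_machine \<equiv> optimal_in machine"

abbreviation optimal_prefix_free_machine :: "(bool list \<rightharpoonup> bool list) \<Rightarrow> bool" where
  "optimal_prefix_free_machine \<equiv> optimal_in prefix_free_machine"

text \<open>
  The complexity of a string with respect to a machine. For an optimal machine every string has a
  description, so the minimum exists. It is the plain complexity \<open>C\<close> if the machine is an optimal
  machine, and the prefix-free complexity \<open>K\<close> if it is an optimal prefix-free machine.
\<close>

definition complexity :: "(bool list \<rightharpoonup> bool list) \<Rightarrow> bool list \<Rightarrow> nat" where
  "complexity M \<sigma> = (LEAST l. \<exists>p. M p = Some \<sigma> \<and> length p = l)"

definition complexity_nat :: "(bool list \<rightharpoonup> bool list) \<Rightarrow> nat \<Rightarrow> nat" where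
  "complexity_nat M n = complexity M (str_decode n)"

section \<open>Martin-Loef randomness\<close>

definition initial_segment :: "(nat \<Rightarrow> bool) \<Rightarrow> nat \<Rightarrow> bool list" where
  "initial_segment A n = map A [0..<n]"

definition generated_open :: "bool list set \<Rightarrow> (nat \<Rightarrow> bool) set" where
  "generated_open W = {A. \<exists>n. initial_segment A n \<in> W}"

definition uniform_measure_cantor :: "(nat \<Rightarrow> bool) measure" where
  "uniform_measure_cantor = PiM UNIV (\<lambda>_. measure_pmf (bernoulli_pmf (1/2)))"

definition uniformly_ce :: "(nat \<Rightarrow> bool list set) \<Rightarrow> bool" where
  "uniformly_ce W \<longleftrightarrow> (\<exists>f. partial_computable f \<and>
     (\<forall>k \<sigma>. \<sigma> \<in> W k \<longleftrightarrow> prod_encode (k, str_code \<sigma>) \<in> dom f))"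

definition Martin_Loef_test :: "(nat \<Rightarrow> bool list set) \<Rightarrow> bool" where
  "Martin_Loef_test W \<longleftrightarrow> uniformly_ce W \<and>
     (\<forall>k. measure uniform_measure_cantor (generated_open (W k)) \<le> (1/2) ^ k)"

definition Martin_Loef_random :: "(nat \<Rightarrow> bool) \<Rightarrow> bool" where
  "Martin_Loef_random A \<longleftrightarrow>
     (\<forall>W. Martin_Loef_test W \<longrightarrow> A \<notin> (\<Inter>k. generated_open (W k)))"

end

theory Submission
  imports Defs
begin

text \<open>
  Let \<open>r\<close> be a computable enumeration of strings of finite total weight \<open>\<Sum>i. 2^(-\<bar>r i\<bar>)\<close>, that is, a Solovay
  test. The expected number of indices \<open>i\<close> such that \<open>r i\<close> is a prefix of a random sequence extending \<open>\<sigma>\<close>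
  is a martingale in \<open>\<sigma>\<close>. By Ville's inequality, a sequence along which it is unbounded is not
  Martin-Loef random. Since a martingale at most doubles from one bit to the next, one can alternate
  two moves: go on until it first exceeds its current bound, which then at most doubles, and after
  that follow bits which do not increase it until \<open>h\<close> has grown beyond the next bound. If the martingale is
  unbounded above every string, the resulting sequence is not random although the martingale stays
  below \<open>h(n) + c\<close> along it. For part (1), \<open>r\<close> lists every string \<open>\<sigma>\<close> at least \<open>\<bar>\<sigma>\<bar> - K(\<sigma>)\<close> times; for part (2),
  at least \<open>\<bar>\<sigma>\<bar> - K(\<bar>\<sigma>\<bar>) - C(\<sigma>)\<close> times. So the martingale bounds both deficiencies.
\<close>

section \<open>Computable functions\<close>

abbreviation pfst :: "nat \<Rightarrow> nat" where "pfst z \<equiv> fst (prod_decode z)"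
abbreviation psnd :: "nat \<Rightarrow> nat" where "psnd z \<equiv> snd (prod_decode z)"

definition computable :: "(nat \<Rightarrow> nat) \<Rightarrow> bool" where
  "computable f \<longleftrightarrow> partial_computable (\<lambda>n. Some (f n))"

lemma partial_computable_id: "partial_computable Some"
  using partial_computable.pair[OF partial_computable.left partial_computable.right] by simp

text \<open>\<open>comp\<close> passes on only the value of \<open>f\<close>, so the argument is
  first paired with it. A function of two arguments is presented through \<open>pfst\<close> and
  \<open>psnd\<close>, which is the form of the hypotheses in the closure lemmas that
  follow.\<close>

lemma partial_computable_bind:
  assumes "partial_computable f" and "partial_computable (\<lambda>z. g (pfst z) (psnd z))"
  shows "partial_computable (\<lambda>x. Option.bind (f x) (g x))"
proof -
  have "partial_computable (\<lambda>x. Option.bind (Option.bind (Some x) (\<lambda>x'.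
           Option.bind (f x) (\<lambda>y. Some (prod_encode (x', y))))) (\<lambda>z. g (pfst z) (psnd z)))"
    by (intro partial_computable.comp partial_computable.pair assms partial_computable_id)
  moreover have "(\<lambda>x. Option.bind (Option.bind (Some x) (\<lambda>x'.
           Option.bind (f x) (\<lambda>y. Some (prod_encode (x', y))))) (\<lambda>z. g (pfst z) (psnd z)))
        = (\<lambda>x. Option.bind (f x) (g x))"
    by (rule ext, case_tac "f x") auto
  ultimately show ?thesis by simp
qed

lemma partial_computable_comp:
  assumes "partial_computable f" and "computable g"
  shows "partial_computable (\<lambda>x. f (g x))"
  using partial_computable.comp[OF assms(1) assms(2)[unfolded computable_def]] by simp

lemma computable_comp: "computable f \<Longrightarrow> computable g \<Longrightarrow> computable (\<lambda>x. f (g x))"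
  unfolding computable_def[of f] computable_def[of "\<lambda>x. f (g x)"]
  by (rule partial_computable_comp)

lemma computable_id: "computable (\<lambda>x. x)"
  using partial_computable_id by (simp add: computable_def)

lemma computable_Suc: "computable f \<Longrightarrow> computable (\<lambda>x. Suc (f x))"
  by (rule computable_comp[of Suc]) (auto simp: computable_def intro: partial_computable.succ)

lemma computable_const: "computable (\<lambda>x. c)"
proof (induction c)
  case 0
  show ?case by (simp add: computable_def partial_computable.zero)
qed (rule computable_Suc)

lemma computable_pfst: "computable f \<Longrightarrow> computable (\<lambda>x. pfst (f x))"
  by (rule computable_comp[of pfst]) (auto simp: computable_def intro: partial_computable.left)

lemma computable_psnd: "computable f \<Longrightarrow> computable (\<lambda>x. psnd (f x))"
  by (rule computable_comp[of psnd]) (auto simp: computable_def intro: partial_computable.right)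

lemma computable_pair:
  "computable f \<Longrightarrow> computable g \<Longrightarrow> computable (\<lambda>x. prod_encode (f x, g x))"
  unfolding computable_def using partial_computable.pair[of "\<lambda>x. Some (f x)" "\<lambda>x. Some (g x)"]
  by simp

lemma partial_computable_rec:
  assumes b: "partial_computable b"
    and s: "partial_computable (\<lambda>z. s (pfst z) (pfst (psnd z)) (psnd (psnd z)))"
    and m: "computable m"
  shows "partial_computable (\<lambda>x. rec_nat (b x) (\<lambda>k r. Option.bind r (s x k)) (m x))"
  using partial_computable_comp[OF partial_computable.prec[OF b s] computable_pair[OF computable_id m]]
  by simp

lemma computable_rec:
  assumes "computable b"
    and "computable (\<lambda>z. s (pfst z) (pfst (psnd z)) (psnd (psnd z)))"
    and "computable m"
  shows "computable (\<lambda>x. rec_nat (b x) (s x) (m x))"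
proof -
  have eq: "rec_nat (Some (b x)) (\<lambda>k r. Option.bind r (\<lambda>y. Some (s x k y))) n
      = Some (rec_nat (b x) (s x) n)" for x n
    by (induction n) auto
  have "partial_computable (\<lambda>x. rec_nat (Some (b x)) (\<lambda>k r. Option.bind r (\<lambda>y. Some (s x k y))) (m x))"
    using assms unfolding computable_def[of b]
      computable_def[of "\<lambda>z. s (pfst z) (pfst (psnd z)) (psnd (psnd z))"]
    by (rule partial_computable_rec)
  then show ?thesis unfolding eq computable_def[symmetric] .
qed

lemma computable_Least:
  assumes "computable (\<lambda>z. p (pfst z) (psnd z))" and ex: "\<And>x. \<exists>n. p x n = 0"
  shows "computable (\<lambda>x. LEAST n. p x n = 0)"
proof -
  have "mu_search (\<lambda>z. Some (p (pfst z) (psnd z))) x = Some (LEAST n. p x n = 0)" for x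
  proof -
    have "p x (LEAST n. p x n = 0) = 0" using ex[of x] by (rule LeastI_ex)
    moreover have "\<forall>m<(LEAST n. p x n = 0). \<exists>y. p x m = Suc y"
      using not_less_Least not0_implies_Suc by blast
    ultimately show ?thesis unfolding mu_search_def by auto
  qed
  moreover have "partial_computable (mu_search (\<lambda>z. Some (p (pfst z) (psnd z))))"
    using assms(1) unfolding computable_def by (rule partial_computable.mu)
  ultimately have "partial_computable (\<lambda>x. Some (LEAST n. p x n = 0))" by presburger
  then show ?thesis by (simp only: computable_def)
qed

text \<open>The search runs over a condition that does not depend on the search variable: it stops
  at once with \<open>0\<close>, or never.\<close>

lemma partial_computable_guard:
  assumes "computable v" and "computable p"
  shows "partial_computable (\<lambda>x. if p x = 0 then Some (v x) else None)"
proof -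
  have "partial_computable (mu_search (\<lambda>z. Some (p (pfst z))))"
    using computable_comp[OF assms(2) computable_pfst[OF computable_id]]
    unfolding computable_def by (rule partial_computable.mu)
  moreover have "mu_search (\<lambda>z. Some (p (pfst z))) x = (if p x = 0 then Some 0 else None)" for x
    unfolding mu_search_def by auto
  then have "mu_search (\<lambda>z. Some (p (pfst z))) = (\<lambda>x. if p x = 0 then Some 0 else None)"
    by (rule ext)
  ultimately have guard: "partial_computable (\<lambda>x. if p x = 0 then Some 0 else None)" by simp
  have "partial_computable (\<lambda>x. Option.bind (if p x = 0 then Some (0::nat) else None) (\<lambda>_. Some (v x)))"
    by (intro partial_computable_bind guard
        computable_comp[OF assms(1) computable_pfst[OF computable_id], unfolded computable_def])
  moreover have "(\<lambda>x. Option.bind (if p x = 0 then Some (0::nat) else None) (\<lambda>_. Some (v x)))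
      = (\<lambda>x. if p x = 0 then Some (v x) else None)"
    by auto
  ultimately show ?thesis by (simp only:)
qed

text \<open>A case distinction built by composition alone would diverge with \<open>f x\<close>. A
  recursion of \<open>p x\<close> steps evaluates \<open>f x\<close> only if there is at least one
  step, and repeating the step does not change the value.\<close>

lemma partial_computable_if:
  assumes "computable p" and "computable d" and "partial_computable f"
  shows "partial_computable (\<lambda>x. if p x = 0 then Some (d x) else f x)"
proof -
  have eq: "rec_nat (Some (d x)) (\<lambda>k r. Option.bind r (\<lambda>_. f x)) n
      = (if n = 0 then Some (d x) else f x)" for x n
    by (induction n) (auto split: if_splits, (cases "f x"; simp))
  have "partial_computable (\<lambda>x. rec_nat (Some (d x)) (\<lambda>k r. Option.bind r (\<lambda>_. f x)) (p x))"
    by (intro partial_computable_rec assms(1) assms(2)[unfolded computable_def]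
        partial_computable_comp[OF assms(3)] computable_pfst computable_id)
  then show ?thesis unfolding eq .
qed

lemma partial_computable_Some: "computable f \<Longrightarrow> partial_computable (\<lambda>x. Some (f x))"
  by (simp add: computable_def)

section \<open>Computability of arithmetic\<close>

lemmas computable_intros = computable_id computable_const computable_Suc computable_pfst
  computable_psnd computable_pair

lemma computable_add:
  assumes "computable f" "computable g" shows "computable (\<lambda>x. f x + g x)"
proof -
  have eq: "m + n = rec_nat m (\<lambda>k r. Suc r) n" for m n :: nat
    by (induction n) auto
  show ?thesis unfolding eq using assms by (intro computable_rec computable_intros)
qed

lemma computable_pred:
  assumes "computable f" shows "computable (\<lambda>x. f x - 1)"
proof -
  have eq: "n - 1 = rec_nat 0 (\<lambda>k r. k) n" for n :: nat
    by (cases n) auto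
  show ?thesis unfolding eq using assms by (intro computable_rec computable_intros)
qed

lemma computable_diff:
  assumes "computable f" "computable g" shows "computable (\<lambda>x. f x - g x)"
proof -
  have eq: "m - n = rec_nat m (\<lambda>k r. r - 1) n" for m n :: nat
    by (induction n) auto
  have "computable (\<lambda>x. rec_nat (f x) (\<lambda>k r. r - 1) (g x))"
    using assms by (intro computable_rec computable_pred computable_intros)
  then show ?thesis unfolding eq[symmetric] .
qed

lemma computable_mult:
  assumes "computable f" "computable g" shows "computable (\<lambda>x. f x * g x)"
proof -
  have eq: "m * n = rec_nat 0 (\<lambda>k r. r + m) n" for m n :: nat
    by (induction n) auto
  show ?thesis unfolding eq using assms
    by (intro computable_rec computable_add assms(1)[THEN computable_comp] computable_intros)
qed

lemma computable_pow2:
  assumes "computable f" shows "computable (\<lambda>x. 2 ^ f x)"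
proof -
  have eq: "(2::nat) ^ n = rec_nat 1 (\<lambda>k r. r + r) n" for n
    by (induction n) auto
  show ?thesis unfolding eq using assms by (intro computable_rec computable_add computable_intros)
qed

lemma computable_half:
  assumes "computable f" shows "computable (\<lambda>x. f x div 2)"
proof -
  have eq: "n div 2 = (LEAST y. n - (2 * y + 1) = 0)" for n :: nat
    by (rule Least_equality[symmetric]) auto
  have "computable (\<lambda>n::nat. n div 2)" unfolding eq
    by (intro computable_Least computable_diff computable_add computable_mult computable_intros)
       (presburger)
  then show ?thesis using assms by (rule computable_comp)
qed

lemmas computable_arith = computable_intros computable_add computable_pred computable_diff
  computable_mult computable_pow2 computable_half

lemma half_funpow: "((\<lambda>x. x div 2) ^^ i) n = n div (2::nat) ^ i"
  by (induction i) (auto simp: div_mult2_eq[symmetric] mult.commute)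

lemma computable_funpow:
  assumes "computable f" "computable g" "computable m" 
  shows "computable (\<lambda>x. (f ^^ m x) (g x))"
proof -
  have eq: "(f ^^ n) y = rec_nat y (\<lambda>k r. f r) n" for n :: nat and y
    by (induction n) auto
  show ?thesis unfolding eq using assms by (intro computable_rec assms(1)[THEN computable_comp] computable_intros)
qed

lemma computable_div_pow2:
  assumes "computable f" "computable g" shows "computable (\<lambda>x. f x div 2 ^ g x)"
  unfolding half_funpow[symmetric] using assms by (intro computable_funpow computable_arith)

section \<open>Operations on strings through their codes\<close>

definition code_butlast :: "nat \<Rightarrow> nat" where "code_butlast x = (x - 1) div 2"

lemma computable_code_butlast: "computable code_butlast"
  unfolding code_butlast_def by (intro computable_arith)

text \<open>The one-bit extensions of a string with code \<open>c\<close> have the codes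
  \<open>2 * c + 1\<close> and \<open>2 * c + 2\<close>. Truncated subtraction fixes the code
  \<open>0\<close> of the empty string, as \<open>butlast\<close> fixes the string.\<close>

lemma code_butlast_str_code: "code_butlast (str_code \<sigma>) = str_code (butlast \<sigma>)"
  by (cases \<sigma> rule: rev_cases) (auto simp: code_butlast_def)

lemma code_butlast_funpow: "(code_butlast ^^ k) (str_code \<sigma>) = str_code (take (length \<sigma> - k) \<sigma>)"
  by (induction k) (auto simp: code_butlast_str_code butlast_take)

lemma str_code_inject [simp]: "str_code \<sigma> = str_code \<tau> \<longleftrightarrow> \<sigma> = \<tau>"
  by (metis str_decode_code)

lemma str_code_eq_0 [simp]: "str_code \<sigma> = 0 \<longleftrightarrow> \<sigma> = []"
  using str_code_inject[of \<sigma> "[]"] by simp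

lemma computable_length:
  assumes "computable f" shows "computable (\<lambda>x. length (str_decode (f x)))"
proof -
  \<comment> \<open>The length is the number of bits to be dropped until the code \<open>0\<close>
    is reached, so it is found by a terminating search.\<close>
  have eq: "length (str_decode c) = (LEAST k. (code_butlast ^^ k) c = 0)" for c
  proof (rule Least_equality[symmetric])
    show "(code_butlast ^^ length (str_decode c)) c = 0"
      using code_butlast_funpow[of "length (str_decode c)" "str_decode c"] by simp
    show "length (str_decode c) \<le> k" if "(code_butlast ^^ k) c = 0" for k
      using that code_butlast_funpow[of k "str_decode c"] by auto
  qed
  have ex: "\<exists>k. (code_butlast ^^ k) c = 0" for c
    using code_butlast_funpow[of "length (str_decode c)" "str_decode c"] by auto
  have "computable (\<lambda>c. length (str_decode c))" unfolding eq
    by (intro computable_Least computable_funpow computable_code_butlast computable_intros ex)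
  then show ?thesis using assms by (rule computable_comp)
qed

lemma computable_take:
  assumes "computable f" "computable g" 
  shows "computable (\<lambda>x. str_code (take (g x) (str_decode (f x))))"
proof -
  have eq: "str_code (take k (str_decode c)) = (code_butlast ^^ (length (str_decode c) - k)) c" for k c
    using code_butlast_funpow[of "length (str_decode c) - k" "str_decode c"]
    by (cases "k \<le> length (str_decode c)") auto
  show ?thesis unfolding eq using assms
    by (intro computable_funpow computable_code_butlast computable_length computable_diff)
qed

lemma computable_of_bool_eq:
  assumes "computable f" "computable g" shows "computable (\<lambda>x. of_bool (f x = g x))"
proof -
  have eq: "of_bool (a = b) = 1 - ((a - b) + (b - a))" for a b :: nat by auto
  show ?thesis unfolding eq using assms by (intro computable_arith)
qed

lemma computable_of_bool_le:
  assumes "computable f" "computable g" shows "computable (\<lambda>x. of_bool (f x \<le> g x))"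
proof -
  have eq: "of_bool (a \<le> b) = 1 - (a - b)" for a b :: nat by auto
  show ?thesis unfolding eq using assms by (intro computable_arith)
qed

section \<open>The martingale of a Solovay test\<close>

text \<open>This turns comparability into an equation between truncated strings, which is decidable
  on codes.\<close>

lemma prefix_comparable_iff: "prefix \<rho> \<tau> \<or> prefix \<tau> \<rho> \<longleftrightarrow> take (length \<rho>) \<tau> = take (length \<tau>) \<rho>"
  by (metis append_eq_conv_conj linorder_linear prefix_def take_all take_is_prefix)

text \<open>The probability that a random sequence extending \<sigma> has the prefix \<tau>. If
  \<tau> is a prefix of \<sigma>, the truncated exponent is \<open>0\<close> and the value is
  \<open>1\<close>.\<close>

definition cond_prob :: "bool list \<Rightarrow> bool list \<Rightarrow> real" where
  "cond_prob \<sigma> \<tau> =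
    (if prefix \<tau> \<sigma> \<or> prefix \<sigma> \<tau> then (1/2) ^ (length \<tau> - length \<sigma>) else 0)"

lemma cond_prob_nonneg: "0 \<le> cond_prob \<sigma> \<tau>"
  by (simp add: cond_prob_def)

lemma cond_prob_le: "cond_prob \<sigma> \<tau> \<le> 2 ^ length \<sigma> * (1/2) ^ length \<tau>"
proof -
  have "(1/2) ^ (length \<tau> - length \<sigma>) \<le> 2 ^ length \<sigma> * (1/2::real) ^ length \<tau>"
    by (cases "length \<sigma> \<le> length \<tau>") (auto simp: power_diff power_one_over field_simps)
  then show ?thesis by (simp add: cond_prob_def)
qed

text \<open>Fairness of the martingale, one string at a time: if \<sigma> is a proper prefix of
  \<tau>, exactly one of the two extensions stays compatible with \<tau>, and there the probability
  doubles.\<close>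

lemma cond_prob_split: "cond_prob (\<sigma> @ [False]) \<tau> + cond_prob (\<sigma> @ [True]) \<tau> = 2 * cond_prob \<sigma> \<tau>"
proof (cases "prefix \<tau> \<sigma>")
  case True
  then have "prefix \<tau> (\<sigma> @ [b])" "length \<tau> \<le> length \<sigma>" for b
    by (auto simp: prefix_length_le)
  with True show ?thesis by (simp add: cond_prob_def)
next
  case False
  show ?thesis
  proof (cases "prefix \<sigma> \<tau>")
    case True
    then obtain \<rho> where "\<tau> = \<sigma> @ \<rho>" by (auto simp: prefix_def)
    with False obtain b \<rho>' where "\<tau> = \<sigma> @ b # \<rho>'" by (cases \<rho>) auto
    then show ?thesis by (cases b) (auto simp: cond_prob_def prefix_def)
  next
    case F: False
    with False have "\<not> prefix \<tau> (\<sigma> @ [b])" "\<not> prefix (\<sigma> @ [b]) \<tau>" for b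
      by (auto dest: append_prefixD)
    with False F show ?thesis by (simp add: cond_prob_def)
  qed
qed

text \<open>\<open>2 ^ N * cond_prob \<sigma> \<tau>\<close>, rounded down to \<open>0\<close> when it is not an integer.\<close>

definition approx_prob :: "nat \<Rightarrow> bool list \<Rightarrow> bool list \<Rightarrow> nat" where
  "approx_prob N \<sigma> \<tau> = of_bool (str_code (take (length \<tau>) \<sigma>) = str_code (take (length \<sigma>) \<tau>))
     * of_bool (length \<tau> - length \<sigma> \<le> N) * 2 ^ (N - (length \<tau> - length \<sigma>))"

lemma real_power2_diff: "d \<le> N \<Longrightarrow> real (2 ^ (N - d)) = 2 ^ N * (1/2) ^ d"
  by (simp only: of_nat_power) (simp add: power_diff power_one_over)

lemma approx_prob_le: "real (approx_prob N \<sigma> \<tau>) \<le> 2 ^ N * cond_prob \<sigma> \<tau>"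
  by (auto simp: approx_prob_def cond_prob_def prefix_comparable_iff real_power2_diff simp del: of_nat_power)

lemma approx_prob_eq: "length \<tau> \<le> N \<Longrightarrow> real (approx_prob N \<sigma> \<tau>) = 2 ^ N * cond_prob \<sigma> \<tau>"
  by (auto simp: approx_prob_def cond_prob_def prefix_comparable_iff real_power2_diff simp del: of_nat_power)

lemma computable_approx_prob:
  assumes "computable f" "computable g" "computable h"
  shows "computable (\<lambda>x. approx_prob (f x) (str_decode (g x)) (str_decode (h x)))"
  unfolding approx_prob_def using assms
  by (intro computable_of_bool_eq computable_of_bool_le computable_take computable_length
      computable_mult computable_pow2 computable_diff)

text \<open>Strings are listed by index, so that a string can count several times. Partiality of
  \<open>r\<close> lets an index wait for a program to halt.\<close>

locale solovay_test =
  fixes r :: "nat \<rightharpoonup> bool list"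
  assumes enumerable: "partial_computable (\<lambda>i. map_option str_code (r i))"
    and summable: "(\<lambda>i. (1/2::real) ^ length (the (r i))) summable_on dom r"
begin

definition expected :: "bool list \<Rightarrow> real" where
  "expected \<sigma> = (\<Sum>\<^sub>\<infinity>i\<in>dom r. cond_prob \<sigma> (the (r i)))"

lemma cond_prob_summable: "(\<lambda>i. cond_prob \<sigma> (the (r i))) summable_on dom r"
  using summable_on_cmult_right[OF summable]
  by (rule summable_on_comparison_test) (auto intro: cond_prob_le cond_prob_nonneg)

lemma sum_le_expected: "finite S \<Longrightarrow> S \<subseteq> dom r \<Longrightarrow> (\<Sum>i\<in>S. cond_prob \<sigma> (the (r i))) \<le> expected \<sigma>"
  unfolding expected_def by (rule finite_sum_le_infsum) (auto intro: cond_prob_summable cond_prob_nonneg)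

lemma expected_nonneg: "0 \<le> expected \<sigma>"
  using sum_le_expected[of "{}"] by simp

text \<open>An index whose string is already a prefix of \<sigma> contributes exactly
  \<open>1\<close>. This is how multiplicities, and later deficiencies, are read off the
  martingale.\<close>

lemma card_le_expected:
  assumes "finite S" and "\<And>i. i \<in> S \<Longrightarrow> \<exists>\<tau>. r i = Some \<tau> \<and> prefix \<tau> \<sigma>"
  shows "card S \<le> expected \<sigma>"
proof -
  have "real (card S) = (\<Sum>i\<in>S. cond_prob \<sigma> (the (r i)))"
    using assms(2) by (subst sum.cong[where h="\<lambda>_. 1", OF refl])
      (fastforce simp: cond_prob_def prefix_length_le)+
  also have "\<dots> \<le> expected \<sigma>"
    using assms by (intro sum_le_expected) auto
  finally show ?thesis .
qed

lemma expected_split: "expected (\<sigma> @ [False]) + expected (\<sigma> @ [True]) = 2 * expected \<sigma>"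
  unfolding expected_def
  by (simp flip: infsum_add infsum_cmult_right' add: cond_prob_summable cond_prob_split)

lemma expected_double: "expected (\<sigma> @ [b]) \<le> 2 * expected \<sigma>"
  using expected_split[of \<sigma>] expected_nonneg[of "\<sigma> @ [False]"] expected_nonneg[of "\<sigma> @ [True]"]
  by (cases b) auto

text \<open>The value at a string is the average over its two one-bit extensions, so one of them
  does not exceed it.\<close>

lemma exists_nonincreasing_extension:
  "\<exists>\<tau>. prefix \<sigma> \<tau> \<and> length \<tau> = length \<sigma> + n
     \<and> (\<forall>\<rho>. prefix \<sigma> \<rho> \<longrightarrow> prefix \<rho> \<tau> \<longrightarrow> expected \<rho> \<le> expected \<sigma>)"
proof (induction n)
  case 0
  show ?case by (rule exI[of _ \<sigma>]) (auto dest: prefix_order.antisym)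
next
  case (Suc n)
  then obtain \<tau> where \<tau>: "prefix \<sigma> \<tau>" "length \<tau> = length \<sigma> + n"
    "\<And>\<rho>. prefix \<sigma> \<rho> \<Longrightarrow> prefix \<rho> \<tau> \<Longrightarrow> expected \<rho> \<le> expected \<sigma>" by blast
  have "\<exists>b. expected (\<tau> @ [b]) \<le> expected \<tau>"
  proof (rule ccontr)
    assume "\<nexists>b. expected (\<tau> @ [b]) \<le> expected \<tau>"
    then have "expected (\<tau> @ [b]) > expected \<tau>" for b by (simp add: not_le)
    from this[of True] this[of False] show False using expected_split[of \<tau>] by linarith
  qed
  then obtain b where "expected (\<tau> @ [b]) \<le> expected \<tau>" by blast
  with \<tau> have "expected (\<tau> @ [b]) \<le> expected \<sigma>" using \<tau>(3)[of \<tau>] by force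
  with \<tau> show ?case by (intro exI[of _ "\<tau> @ [b]"]) auto
qed

text \<open>At a crossing without an earlier one, the string shortened by one bit still has value at
  most \<open>B\<close>, and one bit at most doubles it.\<close>

lemma exists_first_crossing:
  assumes "prefix \<sigma> \<tau>" "expected \<sigma> \<le> B" "B < expected \<tau>"
  shows "\<exists>\<rho>. prefix \<sigma> \<rho> \<and> B < expected \<rho> \<and> expected \<rho> \<le> 2 * B
     \<and> (\<forall>\<pi>. prefix \<sigma> \<pi> \<longrightarrow> strict_prefix \<pi> \<rho> \<longrightarrow> expected \<pi> \<le> B)"
  using assms
proof (induction "length \<tau>" arbitrary: \<tau> rule: less_induct)
  case less
  show ?case
  proof (cases "\<exists>\<pi>. prefix \<sigma> \<pi> \<and> strict_prefix \<pi> \<tau> \<and> B < expected \<pi>")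
    case True
    then show ?thesis using less prefix_length_less by blast
  next
    case False
    have "\<tau> \<noteq> \<sigma>" using less.prems by auto
    with less.prems obtain \<tau>' b where \<tau>': "\<tau> = \<tau>' @ [b]" "prefix \<sigma> \<tau>'"
      by (cases \<tau> rule: rev_cases) auto
    then have "strict_prefix \<tau>' \<tau>" by (simp add: strict_prefix_def)
    with False \<tau>' have "expected \<tau>' \<le> B" by force
    then have "expected \<tau> \<le> 2 * B" using expected_double[of \<tau>' b] \<tau>' by simp
    with False less.prems show ?thesis by (intro exI[of _ \<tau>]) force
  qed
qed

text \<open>One round of the construction: a first crossing of \<open>B\<close>, then
  \<open>N\<close> bits without increase. The free choice of \<open>N\<close> later gives
  \<open>h\<close> time to grow.\<close>

lemma exists_extension_crossing:
  assumes "prefix \<sigma> \<tau>" "expected \<sigma> \<le> B" "B < expected \<tau>"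
  shows "\<exists>\<sigma>'. prefix \<sigma> \<sigma>' \<and> N \<le> length \<sigma>' \<and> (\<exists>\<rho>. prefix \<rho> \<sigma>' \<and> B < expected \<rho>)
     \<and> (\<forall>\<pi>. prefix \<sigma> \<pi> \<longrightarrow> prefix \<pi> \<sigma>' \<longrightarrow> expected \<pi> \<le> 2 * B)"
proof -
  have "0 \<le> B" using assms expected_nonneg[of \<sigma>] by linarith
  obtain \<rho> where \<rho>: "prefix \<sigma> \<rho>" "B < expected \<rho>" "expected \<rho> \<le> 2 * B"
    "\<And>\<pi>. prefix \<sigma> \<pi> \<Longrightarrow> strict_prefix \<pi> \<rho> \<Longrightarrow> expected \<pi> \<le> B"
    using exists_first_crossing[OF assms] by blast
  obtain \<sigma>' where \<sigma>': "prefix \<rho> \<sigma>'" "length \<sigma>' = length \<rho> + N"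
    "\<And>\<pi>. prefix \<rho> \<pi> \<Longrightarrow> prefix \<pi> \<sigma>' \<Longrightarrow> expected \<pi> \<le> expected \<rho>"
    using exists_nonincreasing_extension[of \<rho> N] by blast
  have "expected \<pi> \<le> 2 * B" if "prefix \<sigma> \<pi>" "prefix \<pi> \<sigma>'" for \<pi>
  proof (cases "prefix \<rho> \<pi>")
    case True
    then show ?thesis using \<sigma>'(3)[of \<pi>] \<rho>(3) that by linarith
  next
    case False
    then have "strict_prefix \<pi> \<rho>"
      using that(2) \<sigma>'(1) prefix_same_cases unfolding strict_prefix_def by blast
    then show ?thesis using \<rho>(4)[OF that(1)] \<open>0 \<le> B\<close> by fastforce
  qed
  with \<rho> \<sigma>' show ?thesis by (intro exI[of _ \<sigma>']) auto
qed

end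

section \<open>The uniform measure of cylinders and Kraft's inequality\<close>

lemma initial_segment_length [simp]: "length (initial_segment A n) = n"
  by (simp add: initial_segment_def)

lemma take_initial_segment: "m \<le> n \<Longrightarrow> take m (initial_segment A n) = initial_segment A m"
  by (simp add: initial_segment_def take_map)

definition cylinder :: "bool list \<Rightarrow> (nat \<Rightarrow> bool) set" where
  "cylinder \<tau> = {X. initial_segment X (length \<tau>) = \<tau>}"

lemma prob_space_cantor: "prob_space uniform_measure_cantor"
  unfolding uniform_measure_cantor_def by (intro prob_space_PiM measure_pmf.prob_space_axioms)

interpretation cantor: prob_space uniform_measure_cantor
  by (rule prob_space_cantor)

lemma cylinder_measure:
  "cylinder \<tau> \<in> sets uniform_measure_cantor \<and> measure uniform_measure_cantor (cylinder \<tau>) = (1/2) ^ length \<tau>"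
proof -
  have bernoulli: "product_prob_space (\<lambda>_::nat. measure_pmf (bernoulli_pmf (1/2)))"
    by (intro product_prob_spaceI measure_pmf.prob_space_axioms)
  \<comment> \<open>A cylinder restricts finitely many coordinates to singletons, so the product
    measure is available for it.\<close>
  have eq: "cylinder \<tau> = prod_emb UNIV (\<lambda>_::nat. measure_pmf (bernoulli_pmf (1/2))) {..<length \<tau>}
      (\<Pi>\<^sub>E i\<in>{..<length \<tau>}. {\<tau> ! i})"
  proof (intro set_eqI)
    fix X
    have "X \<in> cylinder \<tau> \<longleftrightarrow> (\<forall>i<length \<tau>. X i = \<tau> ! i)"
      unfolding cylinder_def mem_Collect_eq
      by (subst list_eq_iff_nth_eq) (simp add: initial_segment_def)
    then show "X \<in> cylinder \<tau> \<longleftrightarrow> X \<in> prod_emb UNIV (\<lambda>_::nat. measure_pmf (bernoulli_pmf (1/2))) {..<length \<tau>}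
      (\<Pi>\<^sub>E i\<in>{..<length \<tau>}. {\<tau> ! i})"
      by (simp add: prod_emb_iff PiE_iff Ball_def)
  qed
  have "cylinder \<tau> \<in> sets uniform_measure_cantor"
    unfolding eq uniform_measure_cantor_def by (intro sets_PiM_I) auto
  moreover have "measure uniform_measure_cantor (cylinder \<tau>) = (1/2) ^ length \<tau>"
    unfolding eq uniform_measure_cantor_def
  proof (subst product_prob_space.measure_PiM_emb[OF bernoulli])
    have half: "measure (measure_pmf (bernoulli_pmf (1/2))) {b} = 1/2" for b
      by (cases b) (simp_all add: measure_pmf_single)
    show "(\<Prod>i\<in>{..<length \<tau>}. measure (measure_pmf (bernoulli_pmf (1/2))) {\<tau> ! i}) = (1/2) ^ length \<tau>"
      by (simp only: half prod_constant card_lessThan)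
  qed auto
  ultimately show ?thesis by blast
qed

lemma measure_Union_cylinder:
  assumes "finite T" and "\<And>\<sigma> \<tau>. \<sigma> \<in> T \<Longrightarrow> \<tau> \<in> T \<Longrightarrow> prefix \<sigma> \<tau> \<Longrightarrow> \<sigma> = \<tau>"
  shows "measure uniform_measure_cantor (\<Union>\<tau>\<in>T. cylinder \<tau>) = (\<Sum>\<tau>\<in>T. (1/2) ^ length \<tau>)"
proof -
  have "disjoint_family_on cylinder T"
    unfolding disjoint_family_on_def
  proof (intro ballI impI)
    fix \<sigma> \<tau> assume *: "\<sigma> \<in> T" "\<tau> \<in> T" "\<sigma> \<noteq> \<tau>"
    have "X \<notin> cylinder \<tau>" if X: "X \<in> cylinder \<sigma>" for X
    proof
      assume Y: "X \<in> cylinder \<tau>"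
      have "take (length \<sigma>) \<tau> = \<sigma> \<or> take (length \<tau>) \<sigma> = \<tau>"
        using X Y take_initial_segment[of "length \<sigma>" "length \<tau>" X]
          take_initial_segment[of "length \<tau>" "length \<sigma>" X]
        unfolding cylinder_def by (cases "length \<sigma> \<le> length \<tau>") auto
      then have "prefix \<sigma> \<tau> \<or> prefix \<tau> \<sigma>" by (metis take_is_prefix)
      with * assms(2) show False by blast
    qed
    then show "cylinder \<sigma> \<inter> cylinder \<tau> = {}" by blast
  qed
  then show ?thesis
    using assms(1) cylinder_measure by (subst cantor.finite_measure_finite_Union) auto
qed

text \<open>Pairwise incomparable strings have disjoint cylinders, and the whole space has measure
  \<open>1\<close>.\<close>

lemma Kraft_inequality:
  fixes T :: "bool list set"
  assumes "\<And>\<sigma> \<tau>. \<sigma> \<in> T \<Longrightarrow> \<tau> \<in> T \<Longrightarrow> prefix \<sigma> \<tau> \<Longrightarrow> \<sigma> = \<tau>" and "finite T"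
  shows "(\<Sum>\<tau>\<in>T. (1/2::real) ^ length \<tau>) \<le> 1"
proof -
  have "measure uniform_measure_cantor (\<Union>\<tau>\<in>T. cylinder \<tau>) = (\<Sum>\<tau>\<in>T. (1/2) ^ length \<tau>)"
    using assms by (intro measure_Union_cylinder)
  then show ?thesis by (metis cantor.prob_le_1)
qed

section \<open>Ville's inequality\<close>

context solovay_test
begin

text \<open>Ville's inequality for finitely many bits, as a count. The starting string is arbitrary
  so that the induction can split off the first bit and apply \<open>expected_split\<close>.\<close>

lemma card_crossing_le:
  assumes "0 < B"
  shows "real (card {\<tau>. length \<tau> = n \<and> (\<exists>m\<le>n. B < expected (\<sigma> @ take m \<tau>))}) \<le> 2 ^ n * expected \<sigma> / B"
proof (induction n arbitrary: \<sigma>)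
  case 0
  have "{\<tau>::bool list. length \<tau> = 0 \<and> (\<exists>m\<le>0. B < expected (\<sigma> @ take m \<tau>))}
      = (if B < expected \<sigma> then {[]} else {})" by auto
  then show ?case using assms expected_nonneg[of \<sigma>] by auto
next
  case (Suc n)
  let ?S = "\<lambda>n \<sigma>. {\<tau>. length \<tau> = n \<and> (\<exists>m\<le>n. B < expected (\<sigma> @ take m \<tau>))}"
  show ?case
  proof (cases "B < expected \<sigma>")
    case True
    have fin: "finite {\<tau>::bool list. length \<tau> = Suc n}"
      using finite_lists_length_eq[of "UNIV::bool set" "Suc n"] by simp
    have "card (?S (Suc n) \<sigma>) \<le> card {\<tau>::bool list. length \<tau> = Suc n}"
      by (rule card_mono[OF fin]) auto
    also have "\<dots> = 2 ^ Suc n"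
      using card_lists_length_eq[of "UNIV::bool set" "Suc n"] by simp
    finally have "real (card (?S (Suc n) \<sigma>)) \<le> real (2 ^ Suc n)"
      by (rule of_nat_mono)
    also have "real (2 ^ Suc n) = 2 ^ Suc n" by simp
    also have "\<dots> \<le> 2 ^ Suc n * expected \<sigma> / B"
      using True assms by (simp add: field_simps)
    finally show ?thesis .
  next
    case False
    have fin: "finite (?S n \<sigma>')" for \<sigma>'
      by (rule finite_subset[OF _ finite_lists_length_eq[of "UNIV::bool set" n]]) auto
    \<comment> \<open>Since \<sigma> itself is not above \<open>B\<close>, a crossing needs
      \<open>m > 0\<close> and survives moving the first bit into the starting string.\<close>
    have "?S (Suc n) \<sigma> = Cons False ` ?S n (\<sigma> @ [False]) \<union> Cons True ` ?S n (\<sigma> @ [True])"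
    proof (intro equalityI subsetI)
      fix \<tau> assume "\<tau> \<in> ?S (Suc n) \<sigma>"
      then obtain m where m: "length \<tau> = Suc n" "m \<le> Suc n" "B < expected (\<sigma> @ take m \<tau>)" by blast
      with False obtain m' where m': "m = Suc m'" by (cases m) auto
      from m obtain b \<tau>' where \<tau>: "\<tau> = b # \<tau>'" by (cases \<tau>) auto
      have "\<tau>' \<in> ?S n (\<sigma> @ [b])" using m m' \<tau> by auto
      then have "\<tau> \<in> Cons b ` ?S n (\<sigma> @ [b])" unfolding \<tau> by (rule imageI)
      then show "\<tau> \<in> Cons False ` ?S n (\<sigma> @ [False]) \<union> Cons True ` ?S n (\<sigma> @ [True])"
        by (cases b) (simp_all only: UnI1 UnI2)
    next
      fix \<tau> assume "\<tau> \<in> Cons False ` ?S n (\<sigma> @ [False]) \<union> Cons True ` ?S n (\<sigma> @ [True])"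
      then obtain b \<tau>' where "\<tau> = b # \<tau>'" "\<tau>' \<in> ?S n (\<sigma> @ [b])"
        by (elim UnE imageE) (rule that, assumption+)+
      then obtain m where "\<tau> = b # \<tau>'" "length \<tau>' = n" "m \<le> n" "B < expected ((\<sigma> @ [b]) @ take m \<tau>')"
        by blast
      then have "length \<tau> = Suc n" "Suc m \<le> Suc n" "B < expected (\<sigma> @ take (Suc m) \<tau>)" by simp_all
      then show "\<tau> \<in> ?S (Suc n) \<sigma>" by blast
    qed
    then have "card (?S (Suc n) \<sigma>) \<le> card (Cons False ` ?S n (\<sigma> @ [False])) + card (Cons True ` ?S n (\<sigma> @ [True]))"
      by (simp only: card_Un_le)
    also have "\<dots> \<le> card (?S n (\<sigma> @ [False])) + card (?S n (\<sigma> @ [True]))"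
      by (intro add_mono card_image_le fin)
    finally have "real (card (?S (Suc n) \<sigma>)) \<le> real (card (?S n (\<sigma> @ [False])) + card (?S n (\<sigma> @ [True])))"
      by (rule of_nat_mono)
    also have "\<dots> = real (card (?S n (\<sigma> @ [False]))) + real (card (?S n (\<sigma> @ [True])))"
      by (rule of_nat_add)
    also have "\<dots> \<le> 2 ^ n * expected (\<sigma> @ [False]) / B + 2 ^ n * expected (\<sigma> @ [True]) / B"
      by (intro add_mono Suc.IH)
    also have "\<dots> = 2 ^ n * (expected (\<sigma> @ [False]) + expected (\<sigma> @ [True])) / B"
      by (simp add: distrib_left add_divide_distrib)
    also have "\<dots> = 2 ^ Suc n * expected \<sigma> / B"
      unfolding expected_split by simp
    finally show ?thesis .
  qed
qed

text \<open>The crossings within the first \<open>n\<close> bits form an increasing sequence of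
  finite unions of cylinders, each bounded by the finite version; the bound passes to the
  limit.\<close>

lemma Ville_inequality:
  assumes "0 < B"
  shows "{X. \<exists>m. B < expected (initial_segment X m)} \<in> sets uniform_measure_cantor"
    and "measure uniform_measure_cantor {X. \<exists>m. B < expected (initial_segment X m)} \<le> expected [] / B"
proof -
  define T where "T n = {\<tau>. length \<tau> = n \<and> (\<exists>m\<le>n. B < expected ([] @ take m \<tau>))}" for n
  define S where "S n = (\<Union>\<tau>\<in>T n. cylinder \<tau>)" for n
  have fin: "finite (T n)" for n
    unfolding T_def
    by (rule finite_subset[OF _ finite_lists_length_eq[of "UNIV::bool set" n]]) auto
  have S_iff: "X \<in> S n \<longleftrightarrow> (\<exists>m\<le>n. B < expected (initial_segment X m))" for X n
    unfolding S_def T_def cylinder_def by (auto simp: take_initial_segment)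
  have S_sets: "S n \<in> sets uniform_measure_cantor" for n
    unfolding S_def using fin cylinder_measure by (intro sets.finite_UN) auto
  have S_le: "measure uniform_measure_cantor (S n) \<le> expected [] / B" for n
  proof -
    have "measure uniform_measure_cantor (S n) = (\<Sum>\<tau>\<in>T n. (1/2) ^ length \<tau>)"
      unfolding S_def using fin by (rule measure_Union_cylinder) (auto simp: T_def prefix_def)
    also have "\<dots> = real (card (T n)) * (1/2) ^ n"
      by (simp add: T_def)
    also have "\<dots> \<le> (2 ^ n * expected [] / B) * (1/2) ^ n"
      using card_crossing_le[OF assms, of n "[]"] unfolding T_def by (intro mult_right_mono) auto
    finally show ?thesis by (simp add: power_one_over)
  qed
  have eq: "{X. \<exists>m. B < expected (initial_segment X m)} = (\<Union>n. S n)"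
    using S_iff by auto
  show "{X. \<exists>m. B < expected (initial_segment X m)} \<in> sets uniform_measure_cantor"
    unfolding eq using S_sets by blast
  have "incseq S"
    by (rule monoI) (meson S_iff order_trans subsetI)
  then have "(\<lambda>n. measure uniform_measure_cantor (S n)) \<longlonglongrightarrow> measure uniform_measure_cantor (\<Union>n. S n)"
    using S_sets by (intro cantor.finite_Lim_measure_incseq) auto
  then show "measure uniform_measure_cantor {X. \<exists>m. B < expected (initial_segment X m)} \<le> expected [] / B"
    unfolding eq by (rule LIMSEQ_le_const2) (use S_le in auto)
qed

end

section \<open>From a Solovay test to a Martin-Loef test\<close>

lemma partial_computable_bounded_sum:
  assumes e: "partial_computable e" and F: "computable F" and m: "computable m"
    and g: "computable (\<lambda>z. g (pfst z) (pfst (psnd z)) (psnd (psnd z)))"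
  shows "partial_computable (\<lambda>x. rec_nat (Some 0) (\<lambda>i r. Option.bind r (\<lambda>y.
     if F x div 2 ^ i - 2 * (F x div 2 ^ i div 2) = 0 then Some y
     else Option.bind (e i) (\<lambda>c. Some (y + g x i c)))) (m x))"
proof -
  have g': "computable (\<lambda>z. g (p z) (q z) (s z))" if "computable p" "computable q" "computable s" for p q s
    using computable_comp[OF g computable_pair[OF that(1) computable_pair[OF that(2,3)]]] by simp
  show ?thesis
    by (intro partial_computable_rec partial_computable_if partial_computable_bind m
        partial_computable_comp[OF e] partial_computable_Some g' computable_comp[OF F]
        computable_div_pow2 computable_arith)
qed

text \<open>The condition tests whether bit \<open>i\<close> of \<open>F\<close> is zero, so
  \<open>F\<close> codes a finite set as \<open>set_decode\<close> does. Only members of this set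
  are evaluated: the loop converges exactly if \<open>e\<close> is defined on all members below
  \<open>m\<close>.\<close>

lemma bounded_sum_eq:
  fixes g :: "nat \<Rightarrow> nat \<Rightarrow> nat"
  shows "rec_nat (Some 0) (\<lambda>i r. Option.bind r (\<lambda>y.
     if F div 2 ^ i - 2 * (F div 2 ^ i div 2) = 0 then Some y
     else Option.bind (e i) (\<lambda>c. Some (y + g i c)))) m
   = (if set_decode F \<inter> {..<m} \<subseteq> dom e then Some (\<Sum>i\<in>set_decode F \<inter> {..<m}. g i (the (e i))) else None)"
  (is "?L m = ?R m")
proof (induction m)
  case 0
  show ?case by simp
next
  case (Suc m)
  have bit: "F div 2 ^ m - 2 * (F div 2 ^ m div 2) = 0 \<longleftrightarrow> m \<notin> set_decode F"
  proof -
    have "x - 2 * (x div 2) = 0 \<longleftrightarrow> even x" for x :: nat by presburger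
    then show ?thesis by (simp only: set_decode_def mem_Collect_eq not_not)
  qed
  show ?case
  proof (cases "m \<in> set_decode F")
    case False
    then have "set_decode F \<inter> {..<Suc m} = set_decode F \<inter> {..<m}" by (auto simp: less_Suc_eq)
    then show ?thesis using Suc.IH False bit by (simp add: bind_eq_Some_conv split: if_splits)
  next
    case True
    then have eq: "set_decode F \<inter> {..<Suc m} = insert m (set_decode F \<inter> {..<m})"
      by (auto simp: less_Suc_eq)
    show ?thesis unfolding eq using Suc.IH True bit by (cases "e m") (auto simp: dom_def add.commute)
  qed
qed

text \<open>Hence the code of a finite set is itself a sufficient bound for a loop over its
  members.\<close>

lemma set_decode_subset: "set_decode F \<subseteq> {..<F}"
proof
  fix x assume "x \<in> set_decode F"
  then have "F div 2 ^ x \<noteq> 0" by (metis even_zero set_decode_def mem_Collect_eq)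
  then have "2 ^ x \<le> F" by (simp add: div_eq_0_iff)
  then show "x \<in> {..<F}" by (metis less_exp lessThan_iff less_le_trans)
qed

context solovay_test
begin

text \<open>
  The length of a string in the test encodes a finite set of indices, which only has to be verified to lie in
  the domain of \<open>r\<close>, and the length of the prefix at which the martingale is large. So no dovetailing
  of computations is needed, and a sequence whose martingale gets large has a prefix in the test, because
  every initial segment of the right length will do.
\<close>

definition test_set :: "nat \<Rightarrow> nat \<Rightarrow> bool list set" where
  "test_set C k = {\<sigma>. set_decode (pfst (length \<sigma>)) \<subseteq> dom r \<and>
     C * 2 ^ k * 2 ^ length \<sigma> < (\<Sum>i\<in>set_decode (pfst (length \<sigma>)).
        approx_prob (length \<sigma>) (take (pfst (psnd (length \<sigma>))) \<sigma>) (the (r i)))}"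

lemma uniformly_ce_test_set: "uniformly_ce (test_set C)"
proof -
  define e where "e i = map_option str_code (r i)" for i
  define len where "len z = length (str_decode (psnd z))" for z
  \<comment> \<open>The detour through \<open>str_decode (str_code ...)\<close> gives the argument
    the form that \<open>computable_approx_prob\<close> and \<open>computable_take\<close>
    expect.\<close>
  define g where "g z i c = approx_prob (len z)
     (str_decode (str_code (take (pfst (psnd (len z))) (str_decode (psnd z))))) (str_decode c)" for z and i c :: nat
  \<comment> \<open>The loop diverges if some listed index lies outside \<open>dom r\<close>;
    otherwise the guard converges exactly if the sum exceeds the threshold.\<close>
  define f where "f z = Option.bind (rec_nat (Some 0) (\<lambda>i r. Option.bind r (\<lambda>y.
     if pfst (len z) div 2 ^ i - 2 * (pfst (len z) div 2 ^ i div 2) = 0 then Some y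
     else Option.bind (e i) (\<lambda>c. Some (y + g z i c)))) (pfst (len z)))
     (\<lambda>s. if of_bool (s \<le> C * 2 ^ pfst z * 2 ^ len z) = (0::nat) then Some (0::nat) else None)" for z
  have len: "computable (\<lambda>z. len (h z))" if "computable h" for h
    unfolding len_def using that by (intro computable_length computable_psnd)
  have "partial_computable f"
    unfolding f_def g_def
    by (intro partial_computable_bind partial_computable_bounded_sum partial_computable_guard
        computable_of_bool_le computable_approx_prob computable_take computable_arith len
        enumerable[folded e_def])
  moreover have "\<sigma> \<in> test_set C k \<longleftrightarrow> prod_encode (k, str_code \<sigma>) \<in> dom f" for k \<sigma>
  proof -
    let ?z = "prod_encode (k, str_code \<sigma>)"
    let ?F = "pfst (length \<sigma>)"
    have [simp]: "len ?z = length \<sigma>" by (simp add: len_def)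
    have [simp]: "set_decode ?F \<inter> {..<?F} = set_decode ?F"
      using set_decode_subset by blast
    have [simp]: "dom e = dom r" by (auto simp: e_def)
    have "(\<Sum>i\<in>set_decode ?F. g ?z i (the (e i))) = (\<Sum>i\<in>set_decode ?F.
        approx_prob (length \<sigma>) (take (pfst (psnd (length \<sigma>))) \<sigma>) (the (r i)))" if "set_decode ?F \<subseteq> dom r"
      by (rule sum.cong) (use that in \<open>auto simp: g_def e_def\<close>)
    then show ?thesis
      unfolding f_def bounded_sum_eq by (auto simp: test_set_def domIff not_le)
  qed
  ultimately show ?thesis unfolding uniformly_ce_def by blast
qed

lemma generated_open_test_set:
  "generated_open (test_set C k) \<subseteq> {X. \<exists>m. real C * 2 ^ k < expected (initial_segment X m)}"
proof
  fix X assume "X \<in> generated_open (test_set C k)"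
  then obtain n where n: "initial_segment X n \<in> test_set C k" unfolding generated_open_def by blast
  define S where "S = set_decode (pfst n)"
  \<comment> \<open>The decoded prefix length may exceed \<open>n\<close>; then \<open>take\<close>
    returns the whole segment.\<close>
  define m where "m = min (pfst (psnd n)) n"
  have take: "take (pfst (psnd n)) (initial_segment X n) = initial_segment X m"
    by (simp add: m_def initial_segment_def take_map min_def)
  from n have S: "S \<subseteq> dom r" "C * 2 ^ k * 2 ^ n < (\<Sum>i\<in>S. approx_prob n (initial_segment X m) (the (r i)))"
    by (simp_all add: test_set_def take S_def)
  have "real C * 2 ^ k * 2 ^ n = real (C * 2 ^ k * 2 ^ n)" by simp
  also have "\<dots> < real (\<Sum>i\<in>S. approx_prob n (initial_segment X m) (the (r i)))"
    using S(2) by (simp only: of_nat_less_iff)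
  also have "\<dots> \<le> (\<Sum>i\<in>S. 2 ^ n * cond_prob (initial_segment X m) (the (r i)))"
    unfolding of_nat_sum by (intro sum_mono approx_prob_le)
  also have "\<dots> \<le> 2 ^ n * expected (initial_segment X m)"
    unfolding sum_distrib_left[symmetric]
    by (intro mult_left_mono sum_le_expected) (use S(1) in \<open>auto simp: S_def\<close>)
  finally show "X \<in> {X. \<exists>m. real C * 2 ^ k < expected (initial_segment X m)}"
    by (auto simp: mult.commute[of _ "2 ^ n"])
qed

lemma mem_generated_open_test_set:
  assumes "real C * 2 ^ k < expected (initial_segment X m)"
  shows "X \<in> generated_open (test_set C k)"
proof -
  let ?\<sigma> = "initial_segment X m"
  \<comment> \<open>Half of the gap, so that an \<epsilon>-close finite partial sum still exceeds
    the threshold.\<close>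
  define \<epsilon> where "\<epsilon> = (expected ?\<sigma> - real C * 2 ^ k) / 2"
  have "\<epsilon> > 0" using assms by (simp add: \<epsilon>_def)
  then obtain S where S: "finite S" "S \<subseteq> dom r" "dist (\<Sum>i\<in>S. cond_prob ?\<sigma> (the (r i))) (expected ?\<sigma>) \<le> \<epsilon>"
    using infsum_finite_approximation[OF cond_prob_summable] unfolding expected_def by blast
  then have gt: "real C * 2 ^ k < (\<Sum>i\<in>S. cond_prob ?\<sigma> (the (r i)))"
    using assms by (auto simp: \<epsilon>_def dist_real_def abs_if split: if_splits)
  \<comment> \<open>A bound on the lengths of all strings listed by \<open>S\<close>. Coding it into
    \<open>n\<close> forces \<open>N \<le> n\<close>, where \<open>approx_prob\<close> is
    exact.\<close>
  define N where "N = (\<Sum>i\<in>S. length (the (r i)))"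
  define n where "n = prod_encode (set_encode S, prod_encode (m, N))"
  have "m \<le> n" "N \<le> n"
    unfolding n_def by (meson le_prod_encode_1 le_prod_encode_2 order_trans)+
  have dec: "set_decode (pfst n) = S" "pfst (psnd n) = m"
    using S(1) by (simp_all add: n_def)
  have "real (C * 2 ^ k * 2 ^ n) = 2 ^ n * (real C * 2 ^ k)" by simp
  also have "\<dots> < 2 ^ n * (\<Sum>i\<in>S. cond_prob ?\<sigma> (the (r i)))"
    using gt by (intro mult_strict_left_mono) auto
  also have "\<dots> = (\<Sum>i\<in>S. 2 ^ n * cond_prob ?\<sigma> (the (r i)))"
    by (rule sum_distrib_left)
  also have "\<dots> = (\<Sum>i\<in>S. real (approx_prob n ?\<sigma> (the (r i))))"
  proof (rule sum.cong[OF refl])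
    fix i assume "i \<in> S"
    then have "length (the (r i)) \<le> N"
      unfolding N_def using S(1) by (intro member_le_sum) auto
    then show "2 ^ n * cond_prob ?\<sigma> (the (r i)) = real (approx_prob n ?\<sigma> (the (r i)))"
      using \<open>N \<le> n\<close> by (simp add: approx_prob_eq)
  qed
  also have "\<dots> = real (\<Sum>i\<in>S. approx_prob n ?\<sigma> (the (r i)))" by simp
  finally have "C * 2 ^ k * 2 ^ n < (\<Sum>i\<in>S. approx_prob n ?\<sigma> (the (r i)))"
    by (simp only: of_nat_less_iff)
  then have "initial_segment X n \<in> test_set C k"
    using S(2) \<open>m \<le> n\<close> by (simp add: test_set_def dec take_initial_segment)
  then show ?thesis unfolding generated_open_def by blast
qed

lemma not_Martin_Loef_random_if_unbounded:
  assumes "\<And>B. \<exists>m. B < expected (initial_segment X m)"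
  shows "\<not> Martin_Loef_random X"
proof -
  \<comment> \<open>A positive integer above the initial capital, so that Ville's inequality at
    level \<open>C * 2 ^ k\<close> gives at most \<open>(1/2) ^ k\<close>.\<close>
  define C where "C = nat \<lceil>expected []\<rceil> + 1"
  have C: "0 < real C" "expected [] \<le> real C"
    unfolding C_def using real_nat_ceiling_ge[of "expected []"] by auto
  have "Martin_Loef_test (test_set C)"
    unfolding Martin_Loef_test_def
  proof (intro conjI allI uniformly_ce_test_set)
    fix k
    have pos: "0 < real C * 2 ^ k" using C by simp
    have "measure uniform_measure_cantor (generated_open (test_set C k))
        \<le> measure uniform_measure_cantor {X. \<exists>m. real C * 2 ^ k < expected (initial_segment X m)}"
      by (intro finite_measure.finite_measure_mono[OF prob_space.finite_measure[OF prob_space_cantor]]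
          generated_open_test_set Ville_inequality(1) pos)
    also have "\<dots> \<le> expected [] / (real C * 2 ^ k)"
      by (rule Ville_inequality(2)[OF pos])
    also have "\<dots> \<le> (1/2) ^ k"
      using C by (simp add: power_one_over field_simps)
    finally show "measure uniform_measure_cantor (generated_open (test_set C k)) \<le> (1/2) ^ k" .
  qed
  moreover have "X \<in> (\<Inter>k. generated_open (test_set C k))"
    using assms mem_generated_open_test_set by blast
  ultimately show ?thesis unfolding Martin_Loef_random_def by blast
qed

section \<open>A sequence along which the martingale is unbounded but slow\<close>

lemma exists_slowly_unbounded:
  assumes h: "filterlim h at_top sequentially"
    and unbounded: "\<And>\<sigma> B. \<exists>\<tau>. prefix \<sigma> \<tau> \<and> B < expected \<tau>"
  shows "\<exists>X c. (\<forall>B. \<exists>m. B < expected (initial_segment X m))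
     \<and> (\<forall>n. expected (initial_segment X n) \<le> real (h n + c))"
proof -
  define c where "c = nat \<lceil>expected []\<rceil> + 1"
  have c: "1 \<le> c" "expected [] \<le> real c"
    unfolding c_def using real_nat_ceiling_ge[of "expected []"] by auto
  have "\<exists>N. \<forall>n\<ge>N. c * 2 ^ k \<le> h n" for k
    using h unfolding filterlim_at_top eventually_sequentially by blast
  then obtain N where N: "\<And>k n. N k \<le> n \<Longrightarrow> c * 2 ^ k \<le> h n" by metis
  \<comment> \<open>After stage \<open>k\<close> the string is so long that \<open>h\<close> has
    already reached \<open>c * 2 ^ Suc k\<close>, the bound for the next stage. Stage
    \<open>0\<close> is exempt because it starts at the empty string.\<close>
  let ?P = "\<lambda>k \<sigma>. expected \<sigma> \<le> real (c * 2 ^ k) \<and> (k > 0 \<longrightarrow> N (Suc k) \<le> length \<sigma>)"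
  let ?Q = "\<lambda>k \<sigma> \<sigma>'. prefix \<sigma> \<sigma>' \<and> k < length \<sigma>' \<and> (\<exists>\<rho>. prefix \<rho> \<sigma>' \<and> real (c * 2 ^ k) < expected \<rho>)
     \<and> (\<forall>\<pi>. prefix \<sigma> \<pi> \<longrightarrow> prefix \<pi> \<sigma>' \<longrightarrow> expected \<pi> \<le> real (c * 2 ^ Suc k))"
  have "\<exists>s. s 0 = [] \<and> (\<forall>k. ?P k (s k)) \<and> (\<forall>k. ?Q k (s k) (s (Suc k)))"
  proof -
    have "\<exists>s. \<forall>k. ((k = 0 \<longrightarrow> s k = []) \<and> ?P k (s k)) \<and> ?Q k (s k) (s (Suc k))"
    proof (rule dependent_nat_choice[where P = "\<lambda>k \<sigma>. (k = 0 \<longrightarrow> \<sigma> = []) \<and> ?P k \<sigma>" and Q = ?Q])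
      show "\<exists>\<sigma>. ((0::nat) = 0 \<longrightarrow> \<sigma> = []) \<and> ?P 0 \<sigma>" using c by (intro exI[of _ "[]"]) simp
    next
      fix \<sigma> k assume *: "(k = 0 \<longrightarrow> \<sigma> = []) \<and> ?P k \<sigma>"
      obtain \<tau> where \<tau>: "prefix \<sigma> \<tau>" "real (c * 2 ^ k) < expected \<tau>" using unbounded by blast
      obtain \<sigma>' where \<sigma>': "prefix \<sigma> \<sigma>'" "max (N (Suc (Suc k))) (Suc k) \<le> length \<sigma>'"
        "\<exists>\<rho>. prefix \<rho> \<sigma>' \<and> real (c * 2 ^ k) < expected \<rho>"
        "\<forall>\<pi>. prefix \<sigma> \<pi> \<longrightarrow> prefix \<pi> \<sigma>' \<longrightarrow> expected \<pi> \<le> 2 * real (c * 2 ^ k)"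
        using exists_extension_crossing[OF \<tau>(1) _ \<tau>(2), of "max (N (Suc (Suc k))) (Suc k)"] * by blast
      have "2 * real (c * 2 ^ k) = real (c * 2 ^ Suc k)" by simp
      with \<sigma>' show "\<exists>\<sigma>'. ((Suc k = 0 \<longrightarrow> \<sigma>' = []) \<and> ?P (Suc k) \<sigma>') \<and> ?Q k \<sigma> \<sigma>'"
        by (intro exI[of _ \<sigma>']) auto
    qed
    then show ?thesis by blast
  qed
  then obtain s where s0: "s 0 = []" and P: "\<And>k. ?P k (s k)" and Q: "\<And>k. ?Q k (s k) (s (Suc k))"
    by blast
  have mono: "prefix (s k) (s l)" if "k \<le> l" for k l
    using that by (induction l rule: dec_induct) (use Q prefix_order.trans in blast)+
  have long: "k \<le> length (s k)" for k
    using Q[of "k - 1"] by (cases k) auto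
  \<comment> \<open>The limit of the chain; \<open>s (Suc n)\<close> has at least
    \<open>Suc n\<close> bits, so the index is in range.\<close>
  define X where "X n = s (Suc n) ! n" for n
  have nth: "s k ! n = X n" if "n < length (s k)" for k n
  proof (cases "k \<le> Suc n")
    case True
    then show ?thesis using mono[of k "Suc n"] that by (auto simp: X_def prefix_def nth_append)
  next
    case False
    then show ?thesis using mono[of "Suc n" k] long[of "Suc n"] by (auto simp: X_def prefix_def nth_append)
  qed
  have X: "initial_segment X n = take n (s k)" if "n \<le> length (s k)" for n k
    using that nth by (intro nth_equalityI) (auto simp: initial_segment_def)
  show ?thesis
  \<comment> \<open>The constant \<open>2 * c\<close> covers the first round, during which nothing
    is known about \<open>h\<close>.\<close>
  proof (rule exI[of _ X], rule exI[of _ "2 * c"], intro conjI allI)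
    fix B :: real
    obtain k where "B < 2 ^ k" using real_arch_pow[of 2 B] by auto
    also have "2 ^ k \<le> real (c * 2 ^ k)" using c(1) by simp
    finally have "B < real (c * 2 ^ k)" .
    with Q[of k] obtain \<rho> where \<rho>: "prefix \<rho> (s (Suc k))" "B < expected \<rho>" by auto
    then have "initial_segment X (length \<rho>) = \<rho>"
      by (subst X[of _ "Suc k"]) (auto simp: prefix_length_le prefix_def)
    with \<rho>(2) show "\<exists>m. B < expected (initial_segment X m)" by metis
  next
    fix n
    \<comment> \<open>The round to which position \<open>n\<close> belongs; the maximum exists
      because \<open>s k\<close> has length at least \<open>k\<close>.\<close>
    define k where "k = (GREATEST k. length (s k) \<le> n)"
    have ex: "length (s 0) \<le> n" by (simp add: s0)
    have bound: "\<And>k. length (s k) \<le> n \<Longrightarrow> k \<le> n" using long order_trans by blast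
    have k: "length (s k) \<le> n"
      unfolding k_def using ex bound by (rule GreatestI_nat)
    have k': "n < length (s (Suc k))"
    proof (rule ccontr)
      assume "\<not> n < length (s (Suc k))"
      then have "Suc k \<le> k"
        unfolding k_def using bound by (intro Greatest_le_nat) auto
      then show False by simp
    qed
    have "prefix (s k) (take n (s (Suc k)))"
      using Q[of k] k by (metis k' length_take less_imp_le min.absorb2 prefix_length_prefix take_is_prefix)
    then have le: "expected (initial_segment X n) \<le> real (c * 2 ^ Suc k)"
      using Q[of k] k' X[of n "Suc k"] take_is_prefix by (metis less_imp_le)
    show "expected (initial_segment X n) \<le> real (h n + 2 * c)"
    proof (cases "k = 0")
      case True
      with le show ?thesis by simp
    next
      case False
      with P[of k] k have "c * 2 ^ Suc k \<le> h n" by (intro N) auto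
      with le show ?thesis by linarith
    qed
  qed
qed

end

section \<open>Making the martingale unbounded above every string\<close>

lemma sum_half_power_le: "(\<Sum>t\<in>T. (1/2::real) ^ t) \<le> 2" if "finite T" for T :: "nat set"
proof -
  have "(\<Sum>t\<in>T. (1/2::real) ^ t) \<le> (\<Sum>t. (1/2) ^ t)"
    using that by (intro sum_le_suminf summable_geometric) auto
  then show ?thesis by (simp add: suminf_geometric)
qed

lemma summable_on_if_finite_sums_le:
  fixes f :: "'a \<Rightarrow> real"
  assumes "\<And>x. x \<in> A \<Longrightarrow> 0 \<le> f x" and "\<And>F. finite F \<Longrightarrow> F \<subseteq> A \<Longrightarrow> sum f F \<le> c"
  shows "f summable_on A"
  using assms by (intro nonneg_bdd_above_summable_on) (auto intro!: bdd_aboveI)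

text \<open>
  Appending \<open>str_code \<sigma> + t\<close> zeros to \<open>\<sigma>\<close> keeps the total weight at most \<open>(\<Sum>c. 2^(-c)) (\<Sum>t. 2^(-t)) = 4\<close>, and
  extensions of \<open>\<sigma>\<close> by many zeros have arbitrarily many of these strings as prefixes.
\<close>

definition padded :: "nat \<Rightarrow> bool list" where
  "padded j = str_decode (pfst j) @ replicate (pfst j + psnd j) False"

lemma computable_str_code_padded:
  assumes "computable f" shows "computable (\<lambda>x. str_code (padded (f x)))"
proof -
  have "str_code (\<sigma> @ replicate n False) = ((\<lambda>y. 2 * y + 1) ^^ n) (str_code \<sigma>)" for \<sigma> n
  proof (induction n)
    case (Suc n)
    have "\<sigma> @ replicate (Suc n) False = (\<sigma> @ replicate n False) @ [False]"
      by (simp add: replicate_append_same)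
    with Suc show ?case by (simp only: str_code_snoc) simp
  qed simp
  then have eq: "str_code (padded j) = ((\<lambda>y. 2 * y + 1) ^^ (pfst j + psnd j)) (pfst j)" for j
    by (simp add: padded_def)
  show ?thesis unfolding eq using assms by (intro computable_funpow computable_arith)
qed

lemma summable_padded: "(\<lambda>j. (1/2::real) ^ length (padded j)) summable_on A"
proof (rule summable_on_if_finite_sums_le)
  fix F :: "nat set" assume "finite F" and "F \<subseteq> A"
  let ?F = "prod_decode ` F"
  have "(\<Sum>j\<in>F. (1/2::real) ^ length (padded j)) \<le> (\<Sum>j\<in>F. (1/2) ^ pfst j * (1/2) ^ psnd j)"
    by (intro sum_mono) (simp add: padded_def power_add power_le_one mult_le_cancel_right1 mult_le_one)
  also have "\<dots> = (\<Sum>(c, t)\<in>?F. (1/2) ^ c * (1/2) ^ t)"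
    by (subst sum.reindex) (auto simp: inj_prod_decode case_prod_beta)
  \<comment> \<open>Enlarging the index set to the product of its projections makes the sum factor
    into two geometric sums.\<close>
  also have "\<dots> \<le> (\<Sum>(c, t)\<in>fst ` ?F \<times> snd ` ?F. (1/2) ^ c * (1/2) ^ t)"
    using \<open>finite F\<close> by (intro sum_mono2 subset_fst_snd) auto
  also have "\<dots> = (\<Sum>c\<in>fst ` ?F. (1/2) ^ c) * (\<Sum>t\<in>snd ` ?F. (1/2) ^ t)"
    by (simp add: sum_product sum.cartesian_product)
  also have "\<dots> \<le> 2 * 2"
    using \<open>finite F\<close> by (intro mult_mono sum_half_power_le sum_nonneg) auto
  finally show "(\<Sum>j\<in>F. (1/2::real) ^ length (padded j)) \<le> 4" by simp
qed simp

definition with_padded :: "(nat \<rightharpoonup> bool list) \<Rightarrow> (nat \<rightharpoonup> bool list)" where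
  "with_padded r i = (if even i then Some (padded (i div 2)) else r (i div 2))"

lemma dom_with_padded: "dom (with_padded r) = range ((*) 2) \<union> (\<lambda>j. 2 * j + 1) ` dom r"
proof (intro equalityI subsetI)
  fix i assume i: "i \<in> dom (with_padded r)"
  show "i \<in> range ((*) 2) \<union> (\<lambda>j. 2 * j + 1) ` dom r"
  proof (cases "even i")
    case False
    then have "i = 2 * (i div 2) + 1" by presburger
    moreover have "i div 2 \<in> dom r" using i False by (auto simp: with_padded_def)
    ultimately show ?thesis by blast
  qed auto
qed (auto simp: with_padded_def)

context solovay_test
begin

lemma solovay_test_with_padded: "solovay_test (with_padded r)"
proof
  have even: "even i \<longleftrightarrow> i - 2 * (i div 2) = 0" for i :: nat by presburger
  have "partial_computable (\<lambda>i. if i - 2 * (i div 2) = 0 then Some (str_code (padded (i div 2)))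
     else map_option str_code (r (i div 2)))"
    by (intro partial_computable_if computable_str_code_padded computable_arith
        partial_computable_comp[OF enumerable])
  moreover have "(\<lambda>i. map_option str_code (with_padded r i))
     = (\<lambda>i. if i - 2 * (i div 2) = 0 then Some (str_code (padded (i div 2)))
         else map_option str_code (r (i div 2)))"
    by (rule ext) (simp only: with_padded_def even option.map if_distrib[of "map_option str_code"])
  ultimately show "partial_computable (\<lambda>i. map_option str_code (with_padded r i))"
    by (simp only:)
  let ?f = "\<lambda>i. (1/2::real) ^ length (the (with_padded r i))"
  have "?f \<circ> (*) 2 = (\<lambda>j. (1/2) ^ length (padded j))" "?f \<circ> (\<lambda>j. 2 * j + 1) = (\<lambda>j. (1/2) ^ length (the (r j)))"
    by (auto simp: with_padded_def)
  then have "?f summable_on range ((*) 2)" "?f summable_on (\<lambda>j. 2 * j + 1) ` dom r"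
    using summable_padded summable by (subst summable_on_reindex; simp add: inj_on_def)+
  then show "?f summable_on dom (with_padded r)"
    unfolding dom_with_padded by (rule summable_on_Un_disjoint) (auto, presburger)
qed

lemma with_padded_unbounded:
  "\<exists>\<tau>. prefix \<sigma> \<tau> \<and> B < solovay_test.expected (with_padded r) \<tau>"
proof -
  interpret R: solovay_test "with_padded r" by (rule solovay_test_with_padded)
  define M where "M = nat \<lceil>B\<rceil> + 1"
  define S where "S = (\<lambda>t. 2 * prod_encode (str_code \<sigma>, t)) ` {..<M}"
  let ?\<tau> = "\<sigma> @ replicate (str_code \<sigma> + M) False"
  have "inj_on (\<lambda>t. 2 * prod_encode (str_code \<sigma>, t)) {..<M}"
    by (rule inj_onI) (simp add: prod_encode_eq)
  then have "card S = M" unfolding S_def by (simp add: card_image)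
  have "real (card S) \<le> R.expected ?\<tau>"
  proof (rule R.card_le_expected)
    show "finite S" by (simp add: S_def)
    fix i assume "i \<in> S"
    then obtain t where t: "t < M" "i = 2 * prod_encode (str_code \<sigma>, t)" by (auto simp: S_def)
    have "replicate (str_code \<sigma> + M) False
        = replicate (str_code \<sigma> + t) False @ replicate (M - t) False"
      using t(1) by (simp flip: replicate_add)
    then show "\<exists>\<rho>. with_padded r i = Some \<rho> \<and> prefix \<rho> ?\<tau>"
      using t(2) by (simp add: with_padded_def padded_def)
  qed
  moreover have "B < real M"
    unfolding M_def using real_nat_ceiling_ge[of B] by auto
  ultimately show ?thesis using \<open>card S = M\<close> by (intro exI[of _ ?\<tau>]) auto
qed

text \<open>The interface to complexity. Interleaving keeps every index of \<open>r\<close> at an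
  odd position, so the slow martingale of \<open>with_padded r\<close> also bounds how often
  \<open>r\<close> lists prefixes of the sequence.\<close>

lemma exists_nonrandom_slowly_covered:
  assumes "filterlim h at_top sequentially"
  obtains X c where "\<not> Martin_Loef_random X"
    and "\<forall>n S. finite S \<longrightarrow> (\<forall>i\<in>S. \<exists>\<tau>. r i = Some \<tau> \<and> prefix \<tau> (initial_segment X n)) \<longrightarrow> card S \<le> h n + c"
proof -
  interpret R: solovay_test "with_padded r" by (rule solovay_test_with_padded)
  obtain X c where X: "\<And>B. \<exists>m. B < R.expected (initial_segment X m)"
    "\<And>n. R.expected (initial_segment X n) \<le> real (h n + c)"
    using R.exists_slowly_unbounded[OF assms with_padded_unbounded] by blast
  have "card S \<le> h n + c"
    if S: "finite S" "\<forall>i\<in>S. \<exists>\<tau>. r i = Some \<tau> \<and> prefix \<tau> (initial_segment X n)" for n S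
  proof -
    have "card S = card ((\<lambda>j. 2 * j + 1) ` S)" by (subst card_image) (auto simp: inj_on_def)
    then have "real (card S) = real (card ((\<lambda>j. 2 * j + 1) ` S))" by simp
    also have "\<dots> \<le> R.expected (initial_segment X n)"
      using S by (intro R.card_le_expected) (auto simp: with_padded_def)
    also have "\<dots> \<le> real (h n + c)" by (rule X(2))
    finally show ?thesis by (simp only: of_nat_le_iff)
  qed
  then have "\<forall>n S. finite S \<longrightarrow> (\<forall>i\<in>S. \<exists>\<tau>. r i = Some \<tau> \<and> prefix \<tau> (initial_segment X n)) \<longrightarrow> card S \<le> h n + c"
    by simp
  then show ?thesis by (rule that[OF R.not_Martin_Loef_random_if_unbounded[OF X(1)]])
qed

end

section \<open>Complexity deficiency\<close>

text \<open>A machine that halts only on the empty program is prefix-free, and optimality carries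
  its description over to \<open>U\<close>. Existence is what makes the \<open>LEAST\<close> in
  \<open>complexity\<close> an attained length.\<close>

lemma optimal_prefix_free_describes:
  assumes "optimal_prefix_free_machine U" shows "\<exists>p. U p = Some \<sigma>"
proof -
  define M where "M p = (if p = [] then Some \<sigma> else None)" for p :: "bool list"
  have "partial_computable (\<lambda>n. if n = 0 then Some (str_code \<sigma>) else None)"
    by (intro partial_computable_guard computable_arith)
  moreover have "(\<lambda>n. map_option str_code (M (str_decode n))) = (\<lambda>n. if n = 0 then Some (str_code \<sigma>) else None)"
  proof (rule ext)
    fix n
    have "str_decode n = [] \<longleftrightarrow> n = 0"
      using str_code_eq_0[of "str_decode n"] by simp
    then show "map_option str_code (M (str_decode n)) = (if n = 0 then Some (str_code \<sigma>) else None)"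
      by (simp add: M_def)
  qed
  ultimately have "machine M" unfolding machine_def by (simp only:)
  then have "prefix_free_machine M"
    by (auto simp: prefix_free_machine_def M_def split: if_splits)
  moreover have "M [] = Some \<sigma>" by (simp add: M_def)
  ultimately show ?thesis using assms unfolding optimal_in_def by blast
qed

lemma optimal_describes:
  assumes "optimal_machine V" shows "\<exists>p. V p = Some \<sigma>"
proof -
  have "machine Some"
    unfolding machine_def using partial_computable_id by simp
  then show ?thesis using assms unfolding optimal_in_def by blast
qed

lemma complexity_attained: "\<exists>p. M p = Some \<sigma> \<Longrightarrow> \<exists>p. M p = Some \<sigma> \<and> length p = complexity M \<sigma>"
  unfolding complexity_def by (rule LeastI_ex) blast

lemma partial_computable_machine:
  "machine M \<Longrightarrow> computable f \<Longrightarrow> partial_computable (\<lambda>x. map_option str_code (M (str_decode (f x))))"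
  unfolding machine_def by (rule partial_computable_comp)

text \<open>
  A program \<open>p\<close> for \<open>\<sigma>\<close> contributes the string \<open>\<sigma>\<close> with multiplicity \<open>length \<sigma> - length p\<close>; the second component of
  the index counts the copies.
\<close>

definition prefix_deficiency_test :: "(bool list \<rightharpoonup> bool list) \<Rightarrow> (nat \<rightharpoonup> bool list)" where
  "prefix_deficiency_test U i = (case U (str_decode (pfst i)) of None \<Rightarrow> None
     | Some \<sigma> \<Rightarrow> if length (str_decode (pfst i)) + psnd i < length \<sigma> then Some \<sigma> else None)"

lemma half_power_mult_le_1: "real n * (1/2) ^ n \<le> 1"
  using of_nat_less_two_power[of n, where 'a=real] by (simp add: power_one_over field_simps)

text \<open>With \<open>d = length \<sigma> - length p\<close>, the copies due to \<open>p\<close>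
  weigh \<open>2^(-length p)\<close> times \<open>d * 2^(-d)\<close>, hence at most
  \<open>2^(-length p)\<close>; Kraft's inequality bounds the sum over all programs.\<close>

lemma solovay_test_prefix_deficiency:
  assumes "prefix_free_machine U" shows "solovay_test (prefix_deficiency_test U)"
proof
  have "partial_computable (\<lambda>i. Option.bind (map_option str_code (U (str_decode (pfst i))))
     (\<lambda>c. if of_bool (length (str_decode c) \<le> length (str_decode (pfst i)) + psnd i) = (0::nat)
       then Some c else None))"
    using assms unfolding prefix_free_machine_def
    by (intro partial_computable_bind partial_computable_guard partial_computable_machine
        computable_of_bool_le computable_length computable_arith) auto
  moreover have "(\<lambda>i. map_option str_code (prefix_deficiency_test U i))
     = (\<lambda>i. Option.bind (map_option str_code (U (str_decode (pfst i))))
     (\<lambda>c. if of_bool (length (str_decode c) \<le> length (str_decode (pfst i)) + psnd i) = (0::nat)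
       then Some c else None))"
    by (rule ext) (simp add: prefix_deficiency_test_def split: option.split)
  ultimately show "partial_computable (\<lambda>i. map_option str_code (prefix_deficiency_test U i))"
    by (simp only:)
  let ?w = "\<lambda>i. (1/2::real) ^ length (the (prefix_deficiency_test U i))"
  show "?w summable_on dom (prefix_deficiency_test U)"
  proof (rule summable_on_if_finite_sums_le)
    fix F assume F: "finite F" "F \<subseteq> dom (prefix_deficiency_test U)"
    define P where "P = (\<lambda>i. str_decode (pfst i)) ` F"
    have P: "finite P" "P \<subseteq> dom U"
      using F by (auto simp: P_def prefix_deficiency_test_def split: option.splits)
    define d where "d p = length (the (U p)) - length p" for p
    define G where "G = (SIGMA p:P. {..<d p})"
    have sub: "F \<subseteq> (\<lambda>(p, t). prod_encode (str_code p, t)) ` G"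
    proof
      fix i assume i: "i \<in> F"
      then have "(str_decode (pfst i), psnd i) \<in> G"
        using F(2) by (auto simp: G_def P_def d_def prefix_deficiency_test_def
            split: option.splits if_splits)
      moreover have "i = (\<lambda>(p, t). prod_encode (str_code p, t)) (str_decode (pfst i), psnd i)" by simp
      ultimately show "i \<in> (\<lambda>(p, t). prod_encode (str_code p, t)) ` G" by (rule rev_image_eqI)
    qed
    have "sum ?w F \<le> sum ?w ((\<lambda>(p, t). prod_encode (str_code p, t)) ` G)"
      using P(1) by (intro sum_mono2 sub) (auto simp: G_def)
    also have "\<dots> = (\<Sum>(p, t)\<in>G. ?w (prod_encode (str_code p, t)))"
      by (subst sum.reindex) (auto simp: inj_on_def prod_encode_eq case_prod_beta)
    also have "\<dots> = (\<Sum>p\<in>P. \<Sum>t<d p. ?w (prod_encode (str_code p, t)))"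
      unfolding G_def using P(1) by (subst sum.Sigma) auto
    also have "\<dots> \<le> (\<Sum>p\<in>P. (1/2) ^ length p)"
    proof (rule sum_mono)
      fix p assume "p \<in> P"
      then obtain \<sigma> where \<sigma>: "U p = Some \<sigma>" using P(2) by blast
      have "(\<Sum>t<d p. ?w (prod_encode (str_code p, t))) = (\<Sum>t<d p. (1/2) ^ length \<sigma>)"
        by (intro sum.cong) (auto simp: prefix_deficiency_test_def d_def \<sigma>)
      \<comment> \<open>If \<open>p\<close> is longer than its output, then \<open>d p = 0\<close>
        and both sides vanish.\<close>
      also have "\<dots> = (1/2) ^ length p * (real (d p) * (1/2) ^ d p)"
        by (cases "length p \<le> length \<sigma>") (auto simp: d_def \<sigma> simp flip: power_add)
      also have "\<dots> \<le> (1/2) ^ length p * 1"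
        by (intro mult_left_mono half_power_mult_le_1) simp
      finally show "(\<Sum>t<d p. ?w (prod_encode (str_code p, t))) \<le> (1/2) ^ length p" by simp
    qed
    also have "\<dots> \<le> 1"
      using P(1) by (rule Kraft_inequality[rotated])
        (use assms P(2) in \<open>unfold prefix_free_machine_def, blast\<close>)
    finally show "sum ?w F \<le> 1" .
  qed simp
qed

lemma nonrandom_with_large_prefix_complexity:
  fixes h :: "nat \<Rightarrow> nat"
  assumes U: "optimal_prefix_free_machine U" and h: "filterlim h at_top sequentially"
  shows "\<exists>X. \<not> Martin_Loef_random X \<and>
    (\<exists>c :: int. \<forall>n. int (complexity U (initial_segment X n)) \<ge> int n - int (h n) - c)"
proof -
  have "prefix_free_machine U" using U by (simp add: optimal_in_def)
  then interpret solovay_test "prefix_deficiency_test U" by (rule solovay_test_prefix_deficiency)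
  obtain X c where X: "\<not> Martin_Loef_random X"
    "\<forall>n S. finite S \<longrightarrow> (\<forall>i\<in>S. \<exists>\<tau>. prefix_deficiency_test U i = Some \<tau> \<and> prefix \<tau> (initial_segment X n))
      \<longrightarrow> card S \<le> h n + c"
    by (rule exists_nonrandom_slowly_covered[OF h])
  have "int (complexity U (initial_segment X n)) \<ge> int n - int (h n) - int c" for n
  proof -
    obtain p where p: "U p = Some (initial_segment X n)" "length p = complexity U (initial_segment X n)"
      using complexity_attained[OF optimal_prefix_free_describes[OF U]] by blast
    \<comment> \<open>A shortest program already supplies \<open>n - length p\<close> indices that
      list the segment itself.\<close>
    have "card ((\<lambda>t. prod_encode (str_code p, t)) ` {..<n - length p}) \<le> h n + c"
      by (rule X(2)[rule_format]) (auto simp: prefix_deficiency_test_def p(1))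
    moreover have "inj_on (\<lambda>t. prod_encode (str_code p, t)) {..<n - length p}"
      by (rule inj_onI) (simp add: prod_encode_eq)
    ultimately have "n - length p \<le> h n + c" by (simp add: card_image)
    then show ?thesis unfolding p(2) by linarith
  qed
  with X(1) show ?thesis by blast
qed

text \<open>An index codes a \<open>U\<close>-program \<open>p\<close> for a number, a
  \<open>V\<close>-program \<open>q\<close> for a string of that length, and a counter of copies.
  The number is the code of \<nu>, as in \<open>complexity_nat\<close>. Fixing the length through
  \<open>p\<close> makes the weight controllable by Kraft's inequality for \<open>U\<close>, as
  \<open>V\<close> has none.\<close>

definition plain_deficiency_test ::
  "(bool list \<rightharpoonup> bool list) \<Rightarrow> (bool list \<rightharpoonup> bool list) \<Rightarrow> (nat \<rightharpoonup> bool list)" where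
  "plain_deficiency_test U V i =
    (case U (str_decode (pfst i)) of None \<Rightarrow> None
     | Some \<nu> \<Rightarrow> (case V (str_decode (pfst (psnd i))) of None \<Rightarrow> None
       | Some \<sigma> \<Rightarrow> if length \<sigma> = str_code \<nu> \<and>
           length (str_decode (pfst i)) + length (str_decode (pfst (psnd i))) + psnd (psnd i) < str_code \<nu>
         then Some \<sigma> else None))"

text \<open>Bounds the pairs of program and counter left to one program for the length, whether or
  not \<open>q\<close> halts. Pairs with positive counter come from the previous \<open>L\<close> by
  a shift; the others are strings of length at most \<open>L\<close>.\<close>

lemma card_short_strings_padded:
  "finite {(q :: bool list, t). length q + t < L} \<and> card {(q :: bool list, t). length q + t < L} \<le> 2 * 2 ^ L"
proof (induction L)
  case (Suc L)
  let ?A = "\<lambda>L. {(q :: bool list, t). length q + t < L}"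
  have eq: "?A (Suc L) = (\<lambda>(q, t). (q, Suc t)) ` ?A L \<union> (\<lambda>q. (q, 0)) ` {q. length q \<le> L}"
  proof (intro equalityI subsetI)
    fix x assume "x \<in> ?A (Suc L)"
    then obtain q t where x: "x = (q, t)" "length q + t < Suc L" by auto
    then show "x \<in> (\<lambda>(q, t). (q, Suc t)) ` ?A L \<union> (\<lambda>q. (q, 0)) ` {q. length q \<le> L}"
      by (cases t) (auto intro: rev_image_eqI)
  qed auto
  have short: "finite {q :: bool list. length q \<le> L}" "card {q :: bool list. length q \<le> L} \<le> 2 * 2 ^ L"
  proof -
    show "finite {q :: bool list. length q \<le> L}"
      using finite_lists_length_le[of "UNIV :: bool set" L] by simp
    have "card {q :: bool list. length q \<le> L} = (\<Sum>i\<le>L. 2 ^ i)"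
      using card_lists_length_le[of "UNIV :: bool set" L] by simp
    also have "\<dots> \<le> 2 * 2 ^ L" by (induction L) auto
    finally show "card {q :: bool list. length q \<le> L} \<le> 2 * 2 ^ L" .
  qed
  have "card (?A (Suc L)) \<le> card ((\<lambda>(q, t). (q, Suc t)) ` ?A L) + card ((\<lambda>q. (q, 0::nat)) ` {q :: bool list. length q \<le> L})"
    unfolding eq by (rule card_Un_le)
  also have "\<dots> \<le> card (?A L) + card {q :: bool list. length q \<le> L}"
    using Suc.IH short(1) by (intro add_mono card_image_le) auto
  also have "\<dots> \<le> 2 * 2 ^ Suc L" using Suc.IH short(2) by simp
  finally show ?case unfolding eq using Suc.IH short(1) by (simp add: eq)
qed simp

text \<open>A program \<open>p\<close> for \<open>n\<close> with \<open>length p \<le> n\<close>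
  admits at most \<open>2 * 2^(n - length p)\<close> indices, each of weight \<open>2^(-n)\<close>,
  hence total weight at most \<open>2 * 2^(-length p)\<close>. Kraft's inequality then bounds
  everything by \<open>2\<close>.\<close>

lemma solovay_test_plain_deficiency:
  assumes U: "prefix_free_machine U" and V: "machine V"
  shows "solovay_test (plain_deficiency_test U V)"
proof
  \<comment> \<open>A sum of naturals is zero only if both summands are: the guard is the
    conjunction of the two conditions in the definition.\<close>
  have "partial_computable (\<lambda>i. Option.bind (map_option str_code (U (str_decode (pfst i))))
     (\<lambda>n. Option.bind (map_option str_code (V (str_decode (pfst (psnd i)))))
     (\<lambda>c. if (1 - of_bool (length (str_decode c) = n)) + of_bool (n \<le>
         length (str_decode (pfst i)) + length (str_decode (pfst (psnd i))) + psnd (psnd i)) = (0::nat)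
       then Some c else None)))"
    using U[unfolded prefix_free_machine_def] V
    by (intro partial_computable_bind partial_computable_guard partial_computable_machine
        computable_of_bool_le computable_of_bool_eq computable_length computable_arith) auto
  moreover have "(\<lambda>i. map_option str_code (plain_deficiency_test U V i))
     = (\<lambda>i. Option.bind (map_option str_code (U (str_decode (pfst i))))
     (\<lambda>n. Option.bind (map_option str_code (V (str_decode (pfst (psnd i)))))
     (\<lambda>c. if (1 - of_bool (length (str_decode c) = n)) + of_bool (n \<le>
         length (str_decode (pfst i)) + length (str_decode (pfst (psnd i))) + psnd (psnd i)) = (0::nat)
       then Some c else None)))"
    by (rule ext) (simp add: plain_deficiency_test_def not_le split: option.split)
  ultimately show "partial_computable (\<lambda>i. map_option str_code (plain_deficiency_test U V i))"
    by (simp only:)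
  let ?w = "\<lambda>i. (1/2::real) ^ length (the (plain_deficiency_test U V i))"
  let ?c = "\<lambda>(p, q, t). prod_encode (str_code p, prod_encode (str_code q, t))"
  show "?w summable_on dom (plain_deficiency_test U V)"
  proof (rule summable_on_if_finite_sums_le)
    fix F assume F: "finite F" "F \<subseteq> dom (plain_deficiency_test U V)"
    define P where "P = (\<lambda>i. str_decode (pfst i)) ` F"
    have P: "finite P" "P \<subseteq> dom U"
      using F by (auto simp: P_def plain_deficiency_test_def split: option.splits)
    define d where "d p = str_code (the (U p)) - length p" for p
    define A where "A p = {(q :: bool list, t). length q + t < d p}" for p
    define G where "G = (SIGMA p:P. A p)"
    \<comment> \<open>The common weight of all indices that use \<open>p\<close>. The default
      \<open>0\<close> is for \<open>p\<close> longer than the number it describes: there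
      \<open>A p\<close> is empty, but the cruder bound on its cardinality would be too
      large.\<close>
    define w where "w p = (if length p \<le> str_code (the (U p)) then (1/2::real) ^ str_code (the (U p)) else 0)" for p
    have A: "finite (A p)" "card (A p) \<le> 2 * 2 ^ d p" for p
      using card_short_strings_padded[of "d p"] by (simp_all add: A_def)
    have F_elem: "?c (str_decode (pfst i), str_decode (pfst (psnd i)), psnd (psnd i)) = i
        \<and> (str_decode (pfst i), str_decode (pfst (psnd i)), psnd (psnd i)) \<in> G
        \<and> ?w i = w (str_decode (pfst i))" if "i \<in> F" for i
      using F(2) that by (fastforce simp: G_def P_def A_def d_def w_def plain_deficiency_test_def
          split: option.splits if_splits)
    have sub: "F \<subseteq> ?c ` G"
      using F_elem by (metis (no_types, lifting) imageI subsetI)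
    have "sum ?w F = (\<Sum>i\<in>F. w (str_decode (pfst i)))"
      using F_elem by (intro sum.cong) auto
    also have "\<dots> \<le> (\<Sum>i\<in>?c ` G. w (str_decode (pfst i)))"
      using P(1) A(1) by (intro sum_mono2 sub) (auto simp: G_def w_def)
    also have "\<dots> = (\<Sum>x\<in>G. w (fst x))"
      by (subst sum.reindex) (auto simp: inj_on_def prod_encode_eq case_prod_beta)
    also have "\<dots> = (\<Sum>p\<in>P. \<Sum>x\<in>A p. w p)"
      unfolding G_def using P(1) A(1) by (subst sum.Sigma) (auto simp: case_prod_beta)
    also have "\<dots> \<le> (\<Sum>p\<in>P. 2 * (1/2) ^ length p)"
    proof (rule sum_mono)
      fix p assume "p \<in> P"
      have "(\<Sum>x\<in>A p. w p) = real (card (A p)) * w p" by simp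
      also have "\<dots> \<le> real (2 * 2 ^ d p) * w p"
        using A(2)[of p] by (intro mult_right_mono) (simp_all only: of_nat_le_iff, simp add: w_def)
      also have "\<dots> \<le> 2 * (1/2) ^ length p"
        by (auto simp: w_def d_def power_diff power_one_over)
      finally show "(\<Sum>x\<in>A p. w p) \<le> 2 * (1/2) ^ length p" .
    qed
    also have "\<dots> = 2 * (\<Sum>p\<in>P. (1/2) ^ length p)" by (rule sum_distrib_left[symmetric])
    also have "\<dots> \<le> 2 * 1"
      using P(1) by (intro mult_left_mono Kraft_inequality)
        (use U P(2) in \<open>unfold prefix_free_machine_def, blast\<close>, simp_all)
    finally show "sum ?w F \<le> 2" by simp
  qed simp
qed

lemma nonrandom_with_large_plain_complexity:
  fixes h :: "nat \<Rightarrow> nat"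
  assumes U: "optimal_prefix_free_machine U" and V: "optimal_machine V"
    and h: "filterlim h at_top sequentially"
  shows "\<exists>X. \<not> Martin_Loef_random X \<and> (\<exists>c :: int. \<forall>n. int (complexity V (initial_segment X n))
    \<ge> int n - int (complexity_nat U n) - int (h n) - c)"
proof -
  have "prefix_free_machine U" "machine V" using U V by (simp_all add: optimal_in_def)
  then interpret solovay_test "plain_deficiency_test U V" by (rule solovay_test_plain_deficiency)
  obtain X c where X: "\<not> Martin_Loef_random X"
    "\<forall>n S. finite S \<longrightarrow> (\<forall>i\<in>S. \<exists>\<tau>. plain_deficiency_test U V i = Some \<tau> \<and> prefix \<tau> (initial_segment X n))
      \<longrightarrow> card S \<le> h n + c"
    by (rule exists_nonrandom_slowly_covered[OF h])
  have "int (complexity V (initial_segment X n)) \<ge> int n - int (complexity_nat U n) - int (h n) - int c" for n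
  proof -
    obtain p where p: "U p = Some (str_decode n)" "length p = complexity_nat U n"
      using complexity_attained[OF optimal_prefix_free_describes[OF U]] unfolding complexity_nat_def by blast
    obtain q where q: "V q = Some (initial_segment X n)" "length q = complexity V (initial_segment X n)"
      using complexity_attained[OF optimal_describes[OF V]] by blast
    let ?c = "\<lambda>t. prod_encode (str_code p, prod_encode (str_code q, t))"
    \<comment> \<open>Shortest programs for \<open>n\<close> and for the segment leave room for this
      many values of the counter.\<close>
    have "card (?c ` {..<n - (length p + length q)}) \<le> h n + c"
      by (rule X(2)[rule_format]) (auto simp: plain_deficiency_test_def p(1) q(1))
    moreover have "inj_on ?c {..<n - (length p + length q)}"
      by (rule inj_onI) (simp add: prod_encode_eq)
    ultimately have "n - (length p + length q) \<le> h n + c" by (simp add: card_image)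
    then show ?thesis unfolding p(2) q(2) by linarith
  qed
  with X(1) show ?thesis by blast
qed

theorem mainTheorem2:
  fixes U V :: "bool list \<rightharpoonup> bool list"
  assumes "optimal_prefix_free_machine U"
    and "optimal_machine V"
  shows "(\<not> (\<exists>h :: nat \<Rightarrow> nat. filterlim h at_top sequentially \<and>
            (\<forall>A. (\<exists>c :: int. \<forall>n. int (complexity U (initial_segment A n)) \<ge> int n - int (h n) - c)
               \<longrightarrow> Martin_Loef_random A))) \<and>
         (\<not> (\<exists>h :: nat \<Rightarrow> nat. filterlim h at_top sequentially \<and>
            (\<forall>A. (\<exists>c :: int. \<forall>n. int (complexity V (initial_segment A n))
                     \<ge> int n - int (complexity_nat U n) - int (h n) - c)
               \<longrightarrow> Martin_Loef_random A)))"
proof (intro conjI notI; elim exE conjE)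
  fix h :: "nat \<Rightarrow> nat"
  assume h: "filterlim h at_top sequentially"
    and random: "\<forall>A. (\<exists>c :: int. \<forall>n. int (complexity U (initial_segment A n)) \<ge> int n - int (h n) - c)
      \<longrightarrow> Martin_Loef_random A"
  show False
    using nonrandom_with_large_prefix_complexity[OF assms(1) h] random by blast
next
  fix h :: "nat \<Rightarrow> nat"
  assume h: "filterlim h at_top sequentially"
    and random: "\<forall>A. (\<exists>c :: int. \<forall>n. int (complexity V (initial_segment A n))
        \<ge> int n - int (complexity_nat U n) - int (h n) - c) \<longrightarrow> Martin_Loef_random A"
  show False
    using nonrandom_with_large_plain_complexity[OF assms h] random by blast
qed

end
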